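(* Let $d\ge 3$ and $S=\mathbb{C}[m_0,\ldots,m_d]$. The $3$-minors of the matrix $$H_d^{\Gamma}=\begin{pmatrix} 0 & m_1 & 2m_2 & 3m_3&\cdots& (d-1)m_{d-1}\\ m_0 & m_1 & m_2 & m_3 &\cdots& m_{d-1}\\ m_1 & m_2 & m_3 &m_4 & \cdots& m_d \end{pmatrix}$$ form a Gröbner basis for the homogeneous prime ideal $\mathcal{I}(\mathcal{M}^{\Gamma}_d)\subseteq S$ of the $d$th gamma moment variety $\mathcal{M}^{\Gamma}_d$ with respect to any antidiagonal term order. Moreover, the Hilbert series of $S/\mathcal{I}(\mathcal{M}^{\Gamma}_d)$ is given by $$\frac{1+(d-2)t+\binom{d-1}{2}t^2}{(1-t)^3}.$$
   Context: The moments of the gamma distribution with shape parameter $k$ and scale parameter $\theta$ are $m_0=1$ and $m_i=\theta^i\prod_{j=0}^{i-1}(k+j)$ for $i\ge 1$. The gamma moment variety $\mathcal{M}^{\Gamma}_d\subseteq\mathbb{P}^d$ is the Zariski closure of the image of the map $\mathbb{C}^2\to\mathbb{P}^d$, $(k,\theta)\mapsto[m_0(k,\theta):m_1(k,\theta):\cdots:m_d(k,\theta)]$, and $\mathcal{I}(\cdot)$ denotes the homogeneous vanishing ideal. An antidiagonal term order is a monomial order on $S$ for which the initial monomial of each $3\times 3$ minor of the matrix is (up to a scalar) the product of the entries on its antidiagonal, i.e. for columns $i<j<k$, the product of the entries in positions $(3,i),(2,j),(1,k)$. The polynomial ring $S$ has the standard grading. *)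

theory Defs
  imports
    "HOL-Library.Poly_Mapping"
    "HOL-Algebra.Embedded_Algebras"
    "HOL-Algebra.QuotRing"
    "HOL-Computational_Algebra.Formal_Power_Series"
    "Jordan_Normal_Form.Determinant"
    Complex_Main
begin

section \<open>The polynomial ring\<close>

text \<open>Monomials are exponent vectors, and the variable \<open>m\<^sub>i\<close> has index \<open>i\<close>. The type
  \<open>cpoly\<close> is the ring of complex polynomials in infinitely many variables; \<open>poly_ring d\<close> is its
  subring in the variables \<open>m\<^sub>0, \<dots>, m\<^sub>d\<close>.\<close>

type_synonym mono = "nat \<Rightarrow>\<^sub>0 nat"
type_synonym cpoly = "mono \<Rightarrow>\<^sub>0 complex"

definition monomials :: "nat \<Rightarrow> mono set" where
  "monomials d = {t. Poly_Mapping.keys t \<subseteq> {..d}}"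

definition poly_ring :: "nat \<Rightarrow> cpoly ring" where
  "poly_ring d = \<lparr>carrier = {p. Poly_Mapping.keys p \<subseteq> monomials d},
     monoid.mult = (*), one = 1, zero = 0, add = (+)\<rparr>"

definition Const :: "complex \<Rightarrow> cpoly" where
  "Const c = Poly_Mapping.single 0 c"

definition Var :: "nat \<Rightarrow> cpoly" where
  "Var i = Poly_Mapping.single (Poly_Mapping.single i 1) 1"

definition mono_deg :: "mono \<Rightarrow> nat" where
  "mono_deg t = (\<Sum>i\<in>Poly_Mapping.keys t. Poly_Mapping.lookup t i)"

definition graded_piece :: "nat \<Rightarrow> nat \<Rightarrow> cpoly set" where
  "graded_piece d n =
     {p \<in> carrier (poly_ring d). \<forall>t\<in>Poly_Mapping.keys p. mono_deg t = n}"

definition hom_component :: "nat \<Rightarrow> cpoly \<Rightarrow> cpoly" where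
  "hom_component n p =
     (\<Sum>t\<in>{t \<in> Poly_Mapping.keys p. mono_deg t = n}.
        Poly_Mapping.single t (Poly_Mapping.lookup p t))"

definition homogeneous_ideal :: "nat \<Rightarrow> cpoly set \<Rightarrow> bool" where
  "homogeneous_ideal d I \<longleftrightarrow>
     ideal I (poly_ring d) \<and> (\<forall>p\<in>I. \<forall>n. hom_component n p \<in> I)"


section \<open>Term orders and Groebner bases\<close>

text \<open>A pair \<open>(s, t) \<in> r\<close> means that \<open>s\<close> is at most \<open>t\<close>. Requiring \<open>0\<close> to be the least
  monomial amounts to requiring a well-order, by Dickson's lemma.\<close>

definition term_order :: "nat \<Rightarrow> mono rel \<Rightarrow> bool" where
  "term_order d r \<longleftrightarrow>
     linear_order_on (monomials d) r \<and>
     (\<forall>t\<in>monomials d. (0, t) \<in> r) \<and>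
     (\<forall>s t u. (s, t) \<in> r \<longrightarrow> u \<in> monomials d \<longrightarrow> (s + u, t + u) \<in> r)"

text \<open>For \<open>p = 0\<close> the value of \<open>init_mono r p\<close> is unspecified.\<close>

definition init_mono :: "mono rel \<Rightarrow> cpoly \<Rightarrow> mono" where
  "init_mono r p =
     (THE t. t \<in> Poly_Mapping.keys p \<and> (\<forall>s\<in>Poly_Mapping.keys p. (s, t) \<in> r))"

definition init_ideal :: "nat \<Rightarrow> mono rel \<Rightarrow> cpoly set \<Rightarrow> cpoly set" where
  "init_ideal d r F =
     genideal (poly_ring d) {Poly_Mapping.single (init_mono r f) 1 | f. f \<in> F \<and> f \<noteq> 0}"

definition groebner_basis :: "nat \<Rightarrow> mono rel \<Rightarrow> cpoly set \<Rightarrow> cpoly set \<Rightarrow> bool" where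
  "groebner_basis d r I G \<longleftrightarrow>
     finite G \<and> G \<subseteq> I \<and> init_ideal d r G = init_ideal d r I"


section \<open>Projective varieties\<close>

definition poly_eval :: "cpoly \<Rightarrow> complex vec \<Rightarrow> complex" where
  "poly_eval p v =
     (\<Sum>t\<in>Poly_Mapping.keys p. Poly_Mapping.lookup p t *
        (\<Prod>i\<in>Poly_Mapping.keys t. (v $ i) ^ Poly_Mapping.lookup t i))"

text \<open>A point of projective space is the set of all its homogeneous coordinate vectors.\<close>

definition proj_point :: "complex vec \<Rightarrow> complex vec set" where
  "proj_point v = {c \<cdot>\<^sub>v v | c. c \<noteq> 0}"

definition proj_space :: "nat \<Rightarrow> complex vec set set" where
  "proj_space d = proj_point ` (carrier_vec (d + 1) - {0\<^sub>v (d + 1)})"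

definition homogeneous_polys :: "nat \<Rightarrow> cpoly set" where
  "homogeneous_polys d = (\<Union>n. graded_piece d n)"

definition vanishes_at :: "cpoly \<Rightarrow> complex vec set \<Rightarrow> bool" where
  "vanishes_at f P \<longleftrightarrow> (\<forall>v\<in>P. poly_eval f v = 0)"

definition zero_locus :: "nat \<Rightarrow> cpoly set \<Rightarrow> complex vec set set" where
  "zero_locus d F = {P \<in> proj_space d. \<forall>f\<in>F. vanishes_at f P}"

definition zariski_closure :: "nat \<Rightarrow> complex vec set set \<Rightarrow> complex vec set set" where
  "zariski_closure d X =
     \<Inter>{zero_locus d F | F. F \<subseteq> homogeneous_polys d \<and> X \<subseteq> zero_locus d F}"

definition vanishing_ideal :: "nat \<Rightarrow> complex vec set set \<Rightarrow> cpoly set" where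
  "vanishing_ideal d X =
     genideal (poly_ring d) {f \<in> homogeneous_polys d. \<forall>P\<in>X. vanishes_at f P}"


section \<open>Hilbert series\<close>

text \<open>The quotient \<open>S/I\<close> is regarded as an algebra over the image of the constants; its piece of
  degree \<open>n\<close> is the image of the homogeneous polynomials of degree \<open>n\<close>.\<close>

definition hilbert_function :: "nat \<Rightarrow> cpoly set \<Rightarrow> nat \<Rightarrow> nat" where
  "hilbert_function d I n =
     (let S = poly_ring d
      in ring.dim (S Quot I) (range (\<lambda>c. I +>\<^bsub>S\<^esub> Const c)) ((\<lambda>p. I +>\<^bsub>S\<^esub> p) ` graded_piece d n))"

definition hilbert_series :: "nat \<Rightarrow> cpoly set \<Rightarrow> rat fps" where
  "hilbert_series d I = Abs_fps (\<lambda>n. of_nat (hilbert_function d I n))"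


section \<open>The gamma moment variety\<close>

definition gamma_moment :: "complex \<Rightarrow> complex \<Rightarrow> nat \<Rightarrow> complex" where
  "gamma_moment k \<theta> i = \<theta> ^ i * (\<Prod>j<i. (k + of_nat j))"

definition gamma_moment_variety :: "nat \<Rightarrow> complex vec set set" where
  "gamma_moment_variety d =
     zariski_closure d {proj_point (vec (d + 1) (gamma_moment k \<theta>)) | k \<theta>. True}"

definition gamma_ideal :: "nat \<Rightarrow> cpoly set" where
  "gamma_ideal d = vanishing_ideal d (gamma_moment_variety d)"

text \<open>Rows and columns are indexed from \<open>0\<close>.\<close>

definition gamma_matrix :: "nat \<Rightarrow> cpoly mat" where
  "gamma_matrix d = mat 3 d (\<lambda>(r, j).
     if r = 0 then of_nat j * Var j else if r = 1 then Var j else Var (j + 1))"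

definition col_minor :: "cpoly mat \<Rightarrow> nat \<Rightarrow> nat \<Rightarrow> nat \<Rightarrow> cpoly" where
  "col_minor A i j k = det (mat 3 3 (\<lambda>(r, c). A $$ (r, [i, j, k] ! c)))"

definition minors3 :: "cpoly mat \<Rightarrow> cpoly set" where
  "minors3 A = {col_minor A i j k | i j k. i < j \<and> j < k \<and> k < dim_col A}"

definition antidiagonal_term_order :: "nat \<Rightarrow> cpoly mat \<Rightarrow> mono rel \<Rightarrow> bool" where
  "antidiagonal_term_order d A r \<longleftrightarrow> term_order d r \<and>
     (\<forall>i j k. i < j \<and> j < k \<and> k < dim_col A \<longrightarrow>
        (\<exists>c. c \<noteq> 0 \<and> Const c * Poly_Mapping.single (init_mono r (col_minor A i j k)) 1
               = A $$ (2, i) * A $$ (1, j) * A $$ (0, k)))"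

end

theory Submission
  imports Defs
begin

text \<open>The ideal of the gamma moment variety is the kernel of the substitution
  \<open>m\<^sub>i \<mapsto> s \<theta>\<^sup>i k(k+1)\<cdots>(k+i-1)\<close>, in particular it is prime and homogeneous, and it contains the
  minors. Antidiagonally, the minors lead with \<open>m\<^sub>a m\<^sub>b m\<^sub>c\<close> for \<open>1 \<le> a \<le> b < c < d\<close>; the monomials
  divisible by none of these are \<open>m\<^sub>0\<^sup>a m\<^sub>c\<^sup>e m\<^sub>d\<^sup>b\<close> and \<open>m\<^sub>0\<^sup>a m\<^sub>p m\<^sub>c\<^sup>e m\<^sub>d\<^sup>b\<close> with \<open>p < c < d\<close>.
  Everything follows once the images of these standard monomials are linearly independent. In fixed
  degree and weight (exponent of \<open>\<theta>\<close>) a standard monomial is determined by \<open>(b, c)\<close>, and its image,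
  a polynomial in \<open>k\<close>, vanishes to order exactly \<open>b\<close> at \<open>k = -c\<close>, whereas the images of those with
  lexicographically larger \<open>(b, c)\<close> vanish there to higher order.\<close>

section \<open>Substitution homomorphisms\<close>

definition mono_eval :: "('b \<Rightarrow> 'a::comm_monoid_mult) \<Rightarrow> ('b \<Rightarrow>\<^sub>0 nat) \<Rightarrow> 'a" where
  "mono_eval g t = (\<Prod>i\<in>Poly_Mapping.keys t. g i ^ Poly_Mapping.lookup t i)"

lemma mono_eval_superset:
  assumes "finite A" "Poly_Mapping.keys t \<subseteq> A"
  shows "mono_eval g t = (\<Prod>i\<in>A. g i ^ Poly_Mapping.lookup t i)"
  unfolding mono_eval_def
  by (rule prod.mono_neutral_left) (use assms in \<open>auto simp: in_keys_iff\<close>)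

lemma mono_eval_0 [simp]: "mono_eval g 0 = 1"
  by (simp add: mono_eval_def)

lemma mono_eval_single [simp]: "mono_eval g (Poly_Mapping.single i n) = g i ^ n"
  by (simp add: mono_eval_def)

lemma mono_eval_add: "mono_eval g (s + t) = mono_eval g s * mono_eval g t"
proof -
  let ?A = "Poly_Mapping.keys s \<union> Poly_Mapping.keys t"
  have "Poly_Mapping.keys (s + t) \<subseteq> ?A"
    by (rule Poly_Mapping.keys_add)
  then show ?thesis
    by (simp add: mono_eval_superset[of ?A] lookup_add power_add prod.distrib)
qed

lemma poly_mapping_eq_sum_single:
  "p = (\<Sum>t\<in>Poly_Mapping.keys p. Poly_Mapping.single t (Poly_Mapping.lookup p t))"
  by (rule poly_mapping_eqI) (auto simp: lookup_sum lookup_single when_def in_keys_iff)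

text \<open>The coefficient map \<open>h\<close> is a parameter, so that a ring homomorphism applied
  after a substitution yields a substitution again, as in \<open>hom_poly_subst\<close>. Point
  evaluation and the parametrization of the moments are both instances.\<close>

definition poly_subst :: "('c \<Rightarrow> 'a) \<Rightarrow> ('b \<Rightarrow> 'a) \<Rightarrow> (('b \<Rightarrow>\<^sub>0 nat) \<Rightarrow>\<^sub>0 'c::comm_ring_1) \<Rightarrow> 'a::comm_ring_1"
  where "poly_subst h g p = (\<Sum>t\<in>Poly_Mapping.keys p. h (Poly_Mapping.lookup p t) * mono_eval g t)"

context comm_ring_hom
begin

lemma poly_subst_superset:
  assumes "finite A" "Poly_Mapping.keys p \<subseteq> A"
  shows "poly_subst hom g p = (\<Sum>t\<in>A. hom (Poly_Mapping.lookup p t) * mono_eval g t)"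
  unfolding poly_subst_def
  by (rule sum.mono_neutral_left) (use assms in \<open>auto simp: in_keys_iff\<close>)

lemma poly_subst_0 [simp]: "poly_subst hom g 0 = 0"
  by (simp add: poly_subst_def)

lemma poly_subst_single [simp]:
  "poly_subst hom g (Poly_Mapping.single t c) = hom c * mono_eval g t"
  by (simp add: poly_subst_def)

lemma poly_subst_1 [simp]: "poly_subst hom g 1 = 1"
  using poly_subst_single[of g 0 1] by (simp del: poly_subst_single add: hom_one) 

lemma poly_subst_add: "poly_subst hom g (p + q) = poly_subst hom g p + poly_subst hom g q"
proof -
  let ?A = "Poly_Mapping.keys p \<union> Poly_Mapping.keys q"
  have "Poly_Mapping.keys (p + q) \<subseteq> ?A"
    by (rule Poly_Mapping.keys_add)
  then show ?thesis
    by (simp add: poly_subst_superset[of ?A] lookup_add hom_add distrib_right sum.distrib)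
qed

lemma poly_subst_uminus: "poly_subst hom g (- p) = - poly_subst hom g p"
  using poly_subst_add[of g p "- p"] by (simp add: eq_neg_iff_add_eq_0 add.commute)

lemma poly_subst_diff: "poly_subst hom g (p - q) = poly_subst hom g p - poly_subst hom g q"
  using poly_subst_add[of g p "- q"] by (simp add: poly_subst_uminus)

lemma poly_subst_sum: "poly_subst hom g (\<Sum>x\<in>A. f x) = (\<Sum>x\<in>A. poly_subst hom g (f x))"
  by (induction A rule: infinite_finite_induct) (simp_all add: poly_subst_add)

lemma poly_subst_mult: "poly_subst hom g (p * q) = poly_subst hom g p * poly_subst hom g q"
proof -
  have "p * q = (\<Sum>s\<in>Poly_Mapping.keys p. \<Sum>t\<in>Poly_Mapping.keys q.
      Poly_Mapping.single (s + t) (Poly_Mapping.lookup p s * Poly_Mapping.lookup q t))"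
    by (subst poly_mapping_eq_sum_single[of p], subst poly_mapping_eq_sum_single[of q])
       (simp add: sum_product mult_single)
  then show ?thesis
    by (simp add: poly_subst_sum mono_eval_add hom_mult)
       (simp add: poly_subst_def sum_product algebra_simps)
qed

end

lemma hom_poly_subst:
  assumes "comm_ring_hom f"
  shows "f (poly_subst h g p) = poly_subst (\<lambda>c. f (h c)) (\<lambda>i. f (g i)) p"
proof -
  interpret comm_ring_hom f by fact
  show ?thesis
    by (simp add: poly_subst_def mono_eval_def hom_sum hom_mult hom_prod hom_power)
qed

lemma poly_eval_eq_subst: "poly_eval p v = poly_subst (\<lambda>c. c) (\<lambda>i. v $ i) p"
  by (simp add: poly_eval_def poly_subst_def mono_eval_def)

section \<open>The substitution parametrizing the gamma moments\<close>

definition mono_weight :: "mono \<Rightarrow> nat" where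
  "mono_weight t = (\<Sum>i\<in>Poly_Mapping.keys t. i * Poly_Mapping.lookup t i)"

definition rising :: "nat \<Rightarrow> complex poly" where
  "rising i = (\<Prod>j<i. [:of_nat j, 1:])"

text \<open>Elements of \<open>complex poly poly poly\<close> are polynomials in \<open>s\<close>, then \<open>\<theta>\<close>, then \<open>k\<close>, from the outermost
  to the innermost variable.\<close>

definition gamma_var :: "nat \<Rightarrow> complex poly poly poly" where
  "gamma_var i = monom (monom (rising i) i) 1"

definition gamma_map :: "cpoly \<Rightarrow> complex poly poly poly" where
  "gamma_map = poly_subst (\<lambda>c. [:[:[:c:]:]:]) gamma_var"

interpretation const3: comm_ring_hom "\<lambda>c::complex. [:[:[:c:]:]:]"
  by unfold_locales (simp_all add: pCons_one)

lemmas gamma_map_simps =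
  const3.poly_subst_add[of gamma_var, folded gamma_map_def]
  const3.poly_subst_diff[of gamma_var, folded gamma_map_def]
  const3.poly_subst_uminus[of gamma_var, folded gamma_map_def]
  const3.poly_subst_mult[of gamma_var, folded gamma_map_def]
  const3.poly_subst_sum[of gamma_var, folded gamma_map_def]
  const3.poly_subst_0[of gamma_var, folded gamma_map_def]
  const3.poly_subst_1[of gamma_var, folded gamma_map_def]

text \<open>Degree and weight become the exponents of \<open>s\<close> and \<open>\<theta>\<close>.
  Only the polynomial in the innermost variable can distinguish monomials of equal degree and
  weight.\<close>

lemma mono_eval_gamma_var:
  "mono_eval gamma_var t = monom (monom (mono_eval rising t) (mono_weight t)) (mono_deg t)"
proof -
  have pw: "gamma_var i ^ n = monom (monom (rising i ^ n) (i * n)) n" for i n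
    by (induction n) (simp_all add: gamma_var_def mult_monom)
  have "finite A \<Longrightarrow> (\<Prod>i\<in>A. gamma_var i ^ f i) =
      monom (monom (\<Prod>i\<in>A. rising i ^ f i) (\<Sum>i\<in>A. i * f i)) (\<Sum>i\<in>A. f i)" for A f
    by (induction A rule: finite_induct) (simp_all add: pw mult_monom)
  then show ?thesis
    by (simp add: mono_eval_def mono_weight_def mono_deg_def)
qed

lemma gamma_map_single:
  "gamma_map (Poly_Mapping.single t c) =
     monom (monom (smult c (mono_eval rising t)) (mono_weight t)) (mono_deg t)"
  by (simp add: gamma_map_def mono_eval_gamma_var smult_monom)

lemma gamma_map_Const [simp]: "gamma_map (Const c) = [:[:[:c:]:]:]"
  by (simp add: gamma_map_def Const_def)

lemma gamma_map_eq_sum: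
  "gamma_map p = (\<Sum>t\<in>Poly_Mapping.keys p. monom (monom (smult (Poly_Mapping.lookup p t)
     (mono_eval rising t)) (mono_weight t)) (mono_deg t))"
  by (subst poly_mapping_eq_sum_single[of p])
     (simp only: gamma_map_simps gamma_map_single)

text \<open>A relation between images of monomials can therefore be tested in one degree and weight
  at a time, as an identity in \<open>complex poly\<close>.\<close>

lemma coeff_gamma_map:
  "coeff (coeff (gamma_map p) n) w =
     (\<Sum>t\<in>{t \<in> Poly_Mapping.keys p. mono_deg t = n \<and> mono_weight t = w}.
        smult (Poly_Mapping.lookup p t) (mono_eval rising t))"
proof -
  have "coeff (coeff (gamma_map p) n) w = (\<Sum>t\<in>Poly_Mapping.keys p.
      if mono_deg t = n \<and> mono_weight t = w then smult (Poly_Mapping.lookup p t) (mono_eval rising t) else 0)"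
    unfolding gamma_map_eq_sum coeff_sum by (intro sum.cong) auto
  also have "\<dots> = (\<Sum>t\<in>{t \<in> Poly_Mapping.keys p. mono_deg t = n \<and> mono_weight t = w}.
        smult (Poly_Mapping.lookup p t) (mono_eval rising t))"
    by (rule sum.inter_filter[symmetric]) simp
  finally show ?thesis .
qed

text \<open>The exponent of \<open>s\<close> records the degree, so homogeneous components on the
  source correspond to powers of \<open>s\<close> on the target. This makes the kernel of
  \<open>gamma_map\<close> homogeneous.\<close>

lemma gamma_map_hom_component:
  "gamma_map (hom_component n p) = monom (coeff (gamma_map p) n) n"
proof -
  have "gamma_map (hom_component n p) =
    (\<Sum>t\<in>{t \<in> Poly_Mapping.keys p. mono_deg t = n}. monom (monom (smult (Poly_Mapping.lookup p t)
     (mono_eval rising t)) (mono_weight t)) n)"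
    unfolding hom_component_def gamma_map_simps gamma_map_single by (intro sum.cong) auto
  also have "\<dots> = (\<Sum>t\<in>Poly_Mapping.keys p. if mono_deg t = n then monom (monom (smult (Poly_Mapping.lookup p t)
     (mono_eval rising t)) (mono_weight t)) n else 0)"
    by (rule sum.inter_filter) simp
  also have "\<dots> = monom (coeff (gamma_map p) n) n"
    unfolding gamma_map_eq_sum coeff_sum monom_sum by (intro sum.cong) (auto simp: monom_0)
  finally show ?thesis .
qed

lemma lookup_hom_component:
  "Poly_Mapping.lookup (hom_component n p) t = (if mono_deg t = n then Poly_Mapping.lookup p t else 0)"
  by (auto simp: hom_component_def lookup_sum lookup_single when_def in_keys_iff)

lemma keys_hom_component:
  "Poly_Mapping.keys (hom_component n p) = {t \<in> Poly_Mapping.keys p. mono_deg t = n}"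
  by (auto simp: in_keys_iff lookup_hom_component split: if_splits)

lemma sum_hom_component:
  "p = (\<Sum>n\<in>mono_deg ` Poly_Mapping.keys p. hom_component n p)"
  by (rule poly_mapping_eqI) (auto simp: lookup_sum lookup_hom_component in_keys_iff)

text \<open>The variable \<open>s\<close> plays the scalar by which homogeneous coordinates may be
  rescaled, so all representatives of a projective point are covered. The bound on the keys ensures
  that only entries inside the vector are read.\<close>

lemma poly_eval_gamma:
  assumes "Poly_Mapping.keys p \<subseteq> monomials d"
  shows "poly_eval p (s \<cdot>\<^sub>v vec (d + 1) (gamma_moment k \<theta>)) =
    poly (poly (poly (gamma_map p) [:[:s:]:]) [:\<theta>:]) k"
proof -
  have hom: "comm_ring_hom (\<lambda>P. poly (poly (poly P [:[:s:]:]) [:\<theta>:]) k)"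
    by unfold_locales simp_all
  have g: "poly (poly (poly (gamma_var i) [:[:s:]:]) [:\<theta>:]) k =
      (s \<cdot>\<^sub>v vec (d + 1) (gamma_moment k \<theta>)) $ i" if "i \<le> d" for i
    using that
    by (simp add: gamma_var_def gamma_moment_def poly_monom rising_def poly_prod add.commute poly_const_pow)
  show ?thesis
    unfolding gamma_map_def poly_eval_eq_subst hom_poly_subst[OF hom]
    unfolding poly_subst_def mono_eval_def
    using assms by (intro sum.cong prod.cong arg_cong2[where f="(*)"] refl)
      (auto simp: g monomials_def subset_iff)
qed

lemma poly_eq_0_if_infinite_roots:
  fixes p :: "'a::idom poly"
  assumes "infinite A" "\<And>x. x \<in> A \<Longrightarrow> poly p x = 0"
  shows "p = 0"
  using assms poly_roots_finite[of p] by (meson Collect_mem_eq finite_subset mem_Collect_eq subsetI)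

text \<open>The variables are removed one at a time, from the outermost inwards: a polynomial over
  an integral domain with infinitely many roots is zero. The nonzero values of \<open>s\<close> are
  exactly the scalars occurring in \<open>proj_point\<close>.\<close>

lemma gamma_map_eq_0I:
  fixes P :: "complex poly poly poly"
  assumes "\<And>s \<theta> k. s \<noteq> 0 \<Longrightarrow> poly (poly (poly P [:[:s:]:]) [:\<theta>:]) k = 0"
  shows "P = 0"
proof (rule poly_eq_0_if_infinite_roots)
  have "infinite (UNIV - {0::complex})"
    by (simp add: infinite_UNIV_char_0)
  then show "infinite ((\<lambda>s::complex. [:[:s:]:]) ` (UNIV - {0}))"
    by (subst finite_image_iff) (auto simp: inj_on_def)
next
  fix x :: "complex poly poly"
  assume "x \<in> (\<lambda>s. [:[:s:]:]) ` (UNIV - {0})"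
  then obtain s where s: "x = [:[:s:]:]" "s \<noteq> 0" by auto
  show "poly P x = 0"
  proof (rule poly_eq_0_if_infinite_roots)
    show "infinite (range (\<lambda>t::complex. [:t:]))"
      by (subst finite_image_iff) (auto simp: inj_on_def infinite_UNIV_char_0)
  next
    fix y :: "complex poly"
    assume "y \<in> range (\<lambda>t. [:t:])"
    then obtain t where "y = [:t:]" by auto
    then show "poly (poly P x) y = 0"
      using assms s by (intro poly_eq_0_if_infinite_roots[of UNIV]) (auto simp: infinite_UNIV_char_0)
  qed
qed

section \<open>Degree, weight and support of monomials\<close>

lemma mono_deg_add: "mono_deg (s + t) = mono_deg s + mono_deg t"
  unfolding mono_deg_def by (rule setsum_keys_plus_distrib) auto

lemma mono_weight_add: "mono_weight (s + t) = mono_weight s + mono_weight t"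
  unfolding mono_weight_def by (rule setsum_keys_plus_distrib) (auto simp: distrib_left)

lemma mono_deg_single [simp]: "mono_deg (Poly_Mapping.single i n) = n"
  by (simp add: mono_deg_def)

lemma mono_weight_single [simp]: "mono_weight (Poly_Mapping.single i n) = i * n"
  by (simp add: mono_weight_def)

lemma monomials_0 [simp]: "0 \<in> monomials d"
  by (simp add: monomials_def)

lemma monomials_add_iff: "s + t \<in> monomials d \<longleftrightarrow> s \<in> monomials d \<and> t \<in> monomials d"
proof -
  have "Poly_Mapping.keys (s + t) = Poly_Mapping.keys s \<union> Poly_Mapping.keys t"
    by (auto simp: in_keys_iff lookup_add)
  then show ?thesis
    by (auto simp: monomials_def)
qed

lemma monomials_single_iff: "Poly_Mapping.single i n \<in> monomials d \<longleftrightarrow> n = 0 \<or> i \<le> d"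
  by (simp add: monomials_def)

section \<open>Standard monomials\<close>

text \<open>\<open>minor_lead i j k\<close> is the antidiagonal monomial in columns \<open>i < j < k\<close>; the other two monomials
  of the minor are \<open>minor_lead j i k\<close> and \<open>minor_lead k i j\<close>.\<close>

definition minor_lead :: "nat \<Rightarrow> nat \<Rightarrow> nat \<Rightarrow> mono" where
  "minor_lead i j k =
     Poly_Mapping.single (i + 1) 1 + Poly_Mapping.single j 1 + Poly_Mapping.single k 1"

text \<open>The index \<open>p = 0\<close> encodes the absence of \<open>m\<^sub>p\<close>. For \<open>c \<ge> 2\<close> the variable \<open>m\<^sub>c\<close> is required to occur,
  while \<open>c = 1\<close> also covers the monomials in \<open>m\<^sub>0\<close> and \<open>m\<^sub>d\<close> alone; this makes the indexing injective.\<close>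

definition std_mono :: "nat \<Rightarrow> nat \<times> nat \<times> nat \<times> nat \<times> nat \<Rightarrow> mono" where
  "std_mono d = (\<lambda>(p, c, a, e, b).
     Poly_Mapping.single 0 a + Poly_Mapping.single p (of_bool (0 < p)) +
     Poly_Mapping.single c (e + of_bool (2 \<le> c)) + Poly_Mapping.single d b)"

definition std_index :: "nat \<Rightarrow> nat \<Rightarrow> (nat \<times> nat \<times> nat \<times> nat \<times> nat) set" where
  "std_index d n = {(p, c, a, e, b). p < c \<and> c < d \<and> a + e + b + of_bool (0 < p) + of_bool (2 \<le> c) = n}"

lemma mono_deg_std_mono: "x \<in> std_index d n \<Longrightarrow> mono_deg (std_mono d x) = n"
  by (auto simp: std_index_def std_mono_def mono_deg_add)

lemma std_mono_in_monomials: "x \<in> std_index d n \<Longrightarrow> std_mono d x \<in> monomials d"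
  by (auto simp: std_index_def std_mono_def monomials_add_iff monomials_single_iff)

lemma minor_lead_dvdI:
  assumes "\<And>l. Poly_Mapping.lookup (minor_lead i j k) l \<le> Poly_Mapping.lookup t l"
  shows "\<exists>u. t = u + minor_lead i j k"
  using assms by (intro exI[of _ "t - minor_lead i j k"] poly_mapping_eqI) (auto simp: lookup_add lookup_minus)

text \<open>Under \<open>p < c\<close> and \<open>c < d\<close> the only possible coincidence among
  the indices is \<open>p = 0\<close>; the first branch then takes precedence, in line with
  \<open>p = 0\<close> meaning that \<open>m_p\<close> is absent.\<close>

lemma lookup_std_mono:
  assumes "p < c" "c < d"
  shows "Poly_Mapping.lookup (std_mono d (p, c, a, e, b)) l =
    (if l = 0 then a else if l = p then 1 else if l = c then e + of_bool (2 \<le> c) else if l = d then b else 0)"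
  using assms by (auto simp: std_mono_def lookup_add lookup_single when_def)

text \<open>In a monomial divisible by no lead, let \<open>c\<close> be the largest index in
  \<open>{2..<d}\<close> that occurs. Among the positive indices below \<open>c\<close> at most one
  can then occur, with exponent one, because \<open>m_y^2 m_x\<close> for \<open>y < x\<close> and
  \<open>m_x m_y m_z\<close> for \<open>x < y < z\<close> are leads.\<close>

lemma std_or_lead:
  assumes t: "t \<in> monomials d" and d: "2 \<le> d"
  shows "t \<in> std_mono d ` std_index d (mono_deg t) \<or>
    (\<exists>i j k u. i < j \<and> j < k \<and> k < d \<and> t = u + minor_lead i j k)"
proof (rule disjCI)
  assume no: "\<nexists>i j k u. i < j \<and> j < k \<and> k < d \<and> t = u + minor_lead i j k"
  let ?f = "Poly_Mapping.lookup t"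
  have big: "?f l = 0" if "d < l" for l
    using t that by (auto simp: monomials_def subset_iff in_keys_iff)
  have two: "?f x = 0" if "1 \<le> y" "y < x" "x < d" "2 \<le> ?f y" for x y
  proof (rule ccontr)
    assume x: "?f x \<noteq> 0"
    \<comment> \<open>The first column index is raised by one in the lead, so columns
      \<open>y - 1\<close>, \<open>y\<close>, \<open>x\<close> give the monomial
      \<open>m_y^2 m_x\<close>.\<close>
    have "\<exists>u. t = u + minor_lead (y - 1) y x"
      by (rule minor_lead_dvdI) (use that x in \<open>auto simp: minor_lead_def lookup_add lookup_single when_def\<close>)
    moreover have "y - 1 < y" using that by simp
    ultimately show False
      using that no by blast
  qed
  have three: "?f z = 0" if "1 \<le> x" "x < y" "y < z" "z < d" "?f x \<noteq> 0" "?f y \<noteq> 0" for x y z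
  proof (rule ccontr)
    assume z: "?f z \<noteq> 0"
    have "\<exists>u. t = u + minor_lead (x - 1) y z"
      by (rule minor_lead_dvdI) (use that z in \<open>auto simp: minor_lead_def lookup_add lookup_single when_def\<close>)
    moreover have "x - 1 < y" using that by simp
    ultimately show False
      using that no by blast
  qed
  \<comment> \<open>Index 1 is left out: monomials in \<open>m_0\<close>, \<open>m_1\<close>,
    \<open>m_d\<close> form the case \<open>C = {}\<close>, which is encoded with
    \<open>p = 0\<close> and \<open>c = 1\<close>.\<close>
  define C where "C = {i. 2 \<le> i \<and> i < d \<and> ?f i \<noteq> 0}"
  have finC: "finite C"
    by (rule finite_subset[of _ "{..<d}"]) (auto simp: C_def)
  have "\<exists>p c e. p < c \<and> c < d \<and> (\<forall>l. ?f l = Poly_Mapping.lookup (std_mono d (p, c, ?f 0, e, ?f d)) l)"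
  proof (cases "C = {}")
    case True
    have "?f l = Poly_Mapping.lookup (std_mono d (0, 1, ?f 0, ?f 1, ?f d)) l" for l
    proof -
      consider "l = 0" | "l = 1" | "l = d" | "2 \<le> l" "l < d" | "d < l" by linarith
      then show ?thesis
        using d True big[of l] by cases (auto simp: lookup_std_mono C_def)
    qed
    moreover have "(0::nat) < 1" "1 < d" using d by simp_all
    ultimately show ?thesis by blast
  next
    case False
    define c where "c = Max C"
    have c: "2 \<le> c" "c < d" "?f c \<noteq> 0"
      using Max_in[OF finC False] by (auto simp: c_def C_def)
    have above: "?f l = 0" if "c < l" "l < d" for l
    proof (rule ccontr)
      assume "?f l \<noteq> 0"
      then have "l \<in> C" using that c by (simp add: C_def)
      then have "l \<le> c" unfolding c_def by (rule Max_ge[OF finC])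
      then show False using that by simp
    qed
    show ?thesis
    proof (cases "\<exists>p. 1 \<le> p \<and> p < c \<and> ?f p \<noteq> 0")
      case True
      then obtain p where p: "1 \<le> p" "p < c" "?f p \<noteq> 0" by auto
      have *: "?f p = 1"
        using two[of p c] p c by force
      have **: "?f l = 0" if "l \<noteq> 0" "l \<noteq> p" "l < c" for l
        using three[of l p c] three[of p l c] that p c by (cases l p rule: linorder_cases) force+
      \<comment> \<open>For \<open>2 \<le> c\<close> one factor \<open>m_c\<close> is built into
        \<open>std_mono\<close>, hence the exponent \<open>?f c - 1\<close>.\<close>
      have "?f l = Poly_Mapping.lookup (std_mono d (p, c, ?f 0, ?f c - 1, ?f d)) l" for l
      proof -
        consider "l = 0" | "l = p" | "l = c" | "l = d" | "l \<noteq> 0" "l \<noteq> p" "l < c" | "c < l" "l < d" | "d < l"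
          by linarith
        then show ?thesis
          using p c above[of l] big[of l] * ** by cases (auto simp: lookup_std_mono)
      qed
      then show ?thesis using p c by blast
    next
      case False
      then have *: "?f l = 0" if "l \<noteq> 0" "l < c" for l
        using that by (metis One_nat_def Suc_leI neq0_conv)
      have "?f l = Poly_Mapping.lookup (std_mono d (0, c, ?f 0, ?f c - 1, ?f d)) l" for l
      proof -
        consider "l = 0" | "l = c" | "l = d" | "l \<noteq> 0" "l < c" | "c < l" "l < d" | "d < l"
          by linarith
        then show ?thesis
          using c above[of l] big[of l] * by cases (auto simp: lookup_std_mono)
      qed
      moreover have "0 < c" using c by simp
      ultimately show ?thesis using c by blast
    qed
  qed
  then obtain p c e where pc: "p < c" "c < d"
    and "\<forall>l. ?f l = Poly_Mapping.lookup (std_mono d (p, c, ?f 0, e, ?f d)) l"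
    by blast
  then have eq: "t = std_mono d (p, c, ?f 0, e, ?f d)"
    by (intro poly_mapping_eqI) blast
  have "mono_deg (std_mono d (p, c, ?f 0, e, ?f d)) = ?f 0 + of_bool (0 < p) + (e + of_bool (2 \<le> c)) + ?f d"
    by (simp add: std_mono_def mono_deg_add)
  then have "(p, c, ?f 0, e, ?f d) \<in> std_index d (mono_deg t)"
    using pc unfolding std_index_def eq[symmetric] by simp
  then show "t \<in> std_mono d ` std_index d (mono_deg t)"
    using eq by blast
qed

text \<open>If \<open>c < c'\<close>, then \<open>2 \<le> c'\<close>, so \<open>m_{c'}\<close> is
  forced to occur in one monomial, whereas \<open>c'\<close> differs from every index used in the
  other. Once \<open>c\<close> is known, the exponents determine the remaining entries.\<close>

lemma std_mono_inj: "inj_on (std_mono d) (std_index d n)"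
proof -
  have "p = p' \<and> c = c' \<and> a = a' \<and> e = e' \<and> b = b'"
    if eq: "std_mono d (p, c, a, e, b) = std_mono d (p', c', a', e', b')"
      and x: "p < c" "c < d" and y: "p' < c'" "c' < d"
    for p c a e b p' c' a' e' b'
  proof -
    have f: "(if l = 0 then a else if l = p then 1 else if l = c then e + of_bool (2 \<le> c) else if l = d then b else 0)
      = (if l = 0 then a' else if l = p' then 1 else if l = c' then e' + of_bool (2 \<le> c') else if l = d then b' else 0)" for l
      using arg_cong[OF eq, of "\<lambda>t. Poly_Mapping.lookup t l"] x y by (simp only: lookup_std_mono)
    have "c = c'"
    proof (rule ccontr)
      assume "c \<noteq> c'"
      then consider "c < c'" | "c' < c" by linarith
      then show False
      proof cases
        case 1
        then have "2 \<le> c'" "c' \<noteq> 0" "c' \<noteq> p" "c' \<noteq> c" "c' \<noteq> d" "c' \<noteq> p'" using x y by auto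
        then show False using f[of c'] by simp
      next
        case 2
        then have "2 \<le> c" "c \<noteq> 0" "c \<noteq> p'" "c \<noteq> c'" "c \<noteq> d" "c \<noteq> p" using x y by auto
        then show False using f[of c] by simp
      qed
    qed
    moreover have "p = p'"
    proof (rule ccontr)
      assume "p \<noteq> p'"
      moreover have "p \<noteq> d" "p' \<noteq> d" "p \<noteq> c" "p' \<noteq> c" using x y \<open>c = c'\<close> by auto
      ultimately show False
        using f[of p] f[of p'] \<open>c = c'\<close> by (cases "p = 0"; cases "p' = 0"; simp)
    qed
    moreover have "c \<noteq> 0" "d \<noteq> 0" "c \<noteq> p" "d \<noteq> p" "c \<noteq> d" using x by auto
    ultimately show ?thesis
      using f[of 0] f[of c] f[of d] by simp
  qed
  then show ?thesis
    unfolding std_index_def by (intro inj_onI) auto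
qed

section \<open>Linear independence\<close>

lemma rising_0 [simp]: "rising 0 = 1"
  by (simp add: rising_def)

lemma poly_rising: "poly (rising i) (- of_nat c) = 0 \<longleftrightarrow> c < i"
proof -
  have "(\<exists>j<i. (of_nat j :: complex) - of_nat c = 0) \<longleftrightarrow> c < i"
    by auto
  then show ?thesis
    by (simp add: rising_def poly_prod)
qed

text \<open>The roots \<open>0, -1, ..., -(i - 1)\<close> of \<open>rising i\<close> are simple, so
  for \<open>c < i\<close> a power of \<open>rising i\<close> vanishes at \<open>-c\<close> to an
  order equal to its exponent.\<close>

lemma rising_split:
  assumes "c < i"
  obtains G where "rising i = [:of_nat c, 1:] * G" "poly G (- of_nat c) \<noteq> 0"
proof
  show "rising i = [:of_nat c, 1:] * (\<Prod>j\<in>{..<i} - {c}. [:of_nat j, 1:])"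
    unfolding rising_def using assms by (intro prod.remove) auto
  show "poly (\<Prod>j\<in>{..<i} - {c}. [:of_nat j, 1:]) (- of_nat c) \<noteq> (0 :: complex)"
    by (auto simp: poly_prod)
qed

lemma mono_eval_rising_std_mono:
  "mono_eval rising (std_mono d (p, c, a, e, b)) = rising p * rising c ^ (e + of_bool (2 \<le> c)) * rising d ^ b"
  by (auto simp: std_mono_def mono_eval_add)

lemma mono_weight_std_mono:
  "mono_weight (std_mono d (p, c, a, e, b)) = p + c * (e + of_bool (2 \<le> c)) + d * b"
  by (auto simp: std_mono_def mono_weight_add)

text \<open>After cancelling the common \<open>d * b\<close>, the weight modulo \<open>c\<close> is
  \<open>p\<close>, because \<open>p < c\<close>. The weight then yields \<open>e\<close>, and the
  degree yields \<open>a\<close>.\<close>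

lemma std_index_eqI:
  assumes "(p, c, a, e, b) \<in> std_index d n" "(p', c, a', e', b) \<in> std_index d n"
    and "mono_weight (std_mono d (p, c, a, e, b)) = mono_weight (std_mono d (p', c, a', e', b))"
  shows "(p, c, a, e, b) = (p', c, a', e', b)"
proof -
  have pc: "p < c" "p' < c"
    using assms by (auto simp: std_index_def)
  have w: "p + c * (e + of_bool (2 \<le> c)) = p' + c * (e' + of_bool (2 \<le> c))"
    using assms(3) by (simp add: mono_weight_std_mono)
  have "p = p'"
    using arg_cong[OF w, of "\<lambda>x. x mod c"] pc by (simp only: mod_mult_self2 mod_less)
  moreover from this have "e = e'"
    using w pc by simp
  ultimately show ?thesis
    using assms(1,2) by (auto simp: std_index_def)
qed

lemma std_independent:
  assumes d: "2 \<le> d" and K: "Poly_Mapping.keys q \<subseteq> (\<Union>n. std_mono d ` std_index d n)"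
    and q: "gamma_map q = 0"
  shows "q = 0"
proof (rule ccontr)
  assume "q \<noteq> 0"
  then obtain t0 where t0: "t0 \<in> Poly_Mapping.keys q"
    by (metis all_not_in_conv keys_eq_empty)
  define n where "n = mono_deg t0"
  define w where "w = mono_weight t0"
  define T where "T = {t \<in> Poly_Mapping.keys q. mono_deg t = n \<and> mono_weight t = w}"
  define X where "X = {x \<in> std_index d n. std_mono d x \<in> T}"
  have TX: "\<exists>x\<in>X. t = std_mono d x" if "t \<in> T" for t
  proof -
    have "t \<in> Poly_Mapping.keys q" "mono_deg t = n"
      using that by (simp_all add: T_def)
    then obtain m x where x: "x \<in> std_index d m" "t = std_mono d x"
      using K by blast
    then have "m = n"
      using mono_deg_std_mono \<open>mono_deg t = n\<close> by blast
    then show ?thesis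
      using x that by (auto simp only: X_def)
  qed
  \<comment> \<open>Since \<open>c < d\<close>, comparing \<open>b * d + c\<close> is comparing
    \<open>(b, c)\<close> lexicographically.\<close>
  define key where "key = (\<lambda>(p::nat, c, a::nat, e::nat, b::nat). b * d + c)"
  have "X \<noteq> {}"
    using TX[of t0] t0 by (auto simp: T_def n_def w_def)
  then obtain x where x: "x \<in> X" and min: "\<And>y. y \<in> X \<Longrightarrow> key x \<le> key y"
    using arg_min_nat_lemma[of "\<lambda>x. x \<in> X" _ key] by (metis ex_in_conv)
  obtain p c a e b where xt: "x = (p, c, a, e, b)"
    by (cases x) auto
  have pc: "p < c" "c < d"
    using x by (auto simp: X_def std_index_def xt)
  let ?r = "[:of_nat c, 1:] :: complex poly"
  let ?K = "\<lambda>t. mono_eval rising t"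
  have zero: "(\<Sum>t\<in>T. smult (Poly_Mapping.lookup q t) (?K t)) = 0"
    using coeff_gamma_map[of q n w] by (simp add: q T_def)
  \<comment> \<open>A larger \<open>b'\<close> contributes enough factors of
    \<open>rising d\<close>, which vanishes at \<open>-c\<close> as \<open>c < d\<close>. For
    \<open>b' = b\<close> the larger \<open>c'\<close> contributes one further zero through
    \<open>rising c'\<close>.\<close>
  have other: "?r ^ (b + 1) dvd ?K t" if t: "t \<in> T - {std_mono d x}" for t
  proof -
    obtain y where y: "y \<in> X" "t = std_mono d y" "y \<noteq> x"
      using TX[of t] t by blast
    obtain p' c' a' e' b' where yt: "y = (p', c', a', e', b')"
      by (cases y) auto
    have pc': "p' < c'" "c' < d"
      using y by (auto simp: X_def std_index_def yt)
    have le: "b * d + c \<le> b' * d + c'"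
      using min[OF y(1)] by (simp add: key_def xt yt)
    have rd: "?r dvd rising d"
      using rising_split[OF pc(2)] by (metis dvd_triv_left)
    have "b \<le> b'"
    proof (rule ccontr)
      assume "\<not> b \<le> b'"
      then have "(b' + 1) * d \<le> b * d" by (intro mult_le_mono1) simp
      then show False using le pc' by simp
    qed
    show ?thesis
    proof (cases "b = b'")
      case True
      have "c \<noteq> c'"
      proof
        assume "c = c'"
        then have "x = y"
          using x y True std_index_eqI[of p c a e b d n p' a' e'] unfolding xt yt X_def T_def by simp
        then show False using y by simp
      qed
      \<comment> \<open>The bound \<open>2 \<le> c'\<close> makes the exponent of
        \<open>rising c'\<close> positive even when \<open>e' = 0\<close>.\<close>
      then have "c < c'" "2 \<le> c'"
        using le True pc by auto
      then have "?r dvd rising c'"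
        using rising_split by (metis dvd_triv_left)
      then have "?r dvd rising c' ^ (e' + of_bool (2 \<le> c'))"
        using \<open>2 \<le> c'\<close> by (simp add: dvd_mult2)
      moreover have "?r ^ b dvd rising d ^ b"
        using rd by (rule dvd_power_same)
      ultimately have "?r * ?r ^ b dvd rising c' ^ (e' + of_bool (2 \<le> c')) * rising d ^ b'"
        unfolding True by (rule mult_dvd_mono)
      then show ?thesis
        unfolding y yt mono_eval_rising_std_mono by (simp add: mult.assoc dvd_mult)
    next
      case False
      then have "?r ^ (b + 1) dvd rising d ^ b'"
        using \<open>b \<le> b'\<close> by (intro dvd_power_le[OF rd]) simp
      then show ?thesis
        unfolding y yt mono_eval_rising_std_mono by (rule dvd_mult)
    qed
  qed
  have xT: "std_mono d x \<in> T"
    using x by (simp add: X_def)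
  have "finite T"
    by (simp add: T_def)
  then have "smult (Poly_Mapping.lookup q (std_mono d x)) (?K (std_mono d x)) =
      - (\<Sum>t\<in>T - {std_mono d x}. smult (Poly_Mapping.lookup q t) (?K t))"
    using zero xT by (subst (asm) sum.remove[of _ "std_mono d x"]) (auto simp: eq_neg_iff_add_eq_0)
  also have "?r ^ (b + 1) dvd \<dots>"
    by (subst dvd_minus_iff, rule dvd_sum, rule dvd_smult, rule other)
  finally have dv: "?r ^ (b + 1) dvd ?K (std_mono d x)"
    using xT by (simp add: dvd_smult_iff T_def in_keys_iff)
  obtain G where G: "rising d = ?r * G" "poly G (- of_nat c) \<noteq> 0"
    using rising_split[OF pc(2)] .
  \<comment> \<open>\<open>R\<close> is the cofactor of \<open>?r ^ b\<close> in the image of the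
    minimal monomial. It has no zero at \<open>-c\<close>, because \<open>p < c\<close> and the root
    \<open>-c\<close> first appears in \<open>rising (c + 1)\<close>.\<close>
  define R where "R = rising p * rising c ^ (e + of_bool (2 \<le> c)) * G ^ b"
  have "?K (std_mono d x) = ?r ^ b * R"
    unfolding xt mono_eval_rising_std_mono G R_def by (simp only: power_mult_distrib ac_simps)
  then have "?r ^ b * ?r dvd ?r ^ b * R"
    using dv by (simp only: power_add power_one_right)
  then have "?r dvd R"
    by (subst (asm) dvd_mult_cancel_left) auto
  then have "poly R (- of_nat c) = 0"
    using poly_eq_0_iff_dvd[of R "- of_nat c"] by simp
  then show False
    using pc G(2) by (auto simp: R_def poly_rising)
qed

section \<open>The polynomial ring and the gamma ideal\<close>

lemma poly_ring_simps [simp]: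
  "monoid.mult (poly_ring d) = (*)" "one (poly_ring d) = 1"
  "zero (poly_ring d) = 0" "add (poly_ring d) = (+)"
  by (simp_all add: poly_ring_def)

lemma in_poly_ring: "p \<in> carrier (poly_ring d) \<longleftrightarrow> Poly_Mapping.keys p \<subseteq> monomials d"
  by (simp add: poly_ring_def)

lemma keys_uminus: "Poly_Mapping.keys (- p) = Poly_Mapping.keys (p :: 'a \<Rightarrow>\<^sub>0 'b::ab_group_add)"
  by (auto simp: in_keys_iff)

lemma poly_ring_add: "p \<in> carrier (poly_ring d) \<Longrightarrow> q \<in> carrier (poly_ring d) \<Longrightarrow> p + q \<in> carrier (poly_ring d)"
  unfolding in_poly_ring using Poly_Mapping.keys_add[of p q] by blast

lemma poly_ring_uminus: "p \<in> carrier (poly_ring d) \<Longrightarrow> - p \<in> carrier (poly_ring d)"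
  by (simp add: in_poly_ring keys_uminus)

lemma poly_ring_diff: "p \<in> carrier (poly_ring d) \<Longrightarrow> q \<in> carrier (poly_ring d) \<Longrightarrow> p - q \<in> carrier (poly_ring d)"
  using poly_ring_add[of p d "- q"] by (simp add: poly_ring_uminus)

lemma poly_ring_mult: "p \<in> carrier (poly_ring d) \<Longrightarrow> q \<in> carrier (poly_ring d) \<Longrightarrow> p * q \<in> carrier (poly_ring d)"
  unfolding in_poly_ring using keys_mult[of p q] by (fastforce simp: monomials_add_iff)

lemma poly_ring_single: "t \<in> monomials d \<Longrightarrow> Poly_Mapping.single t c \<in> carrier (poly_ring d)"
  by (simp add: in_poly_ring)

lemma poly_ring_Const: "Const c \<in> carrier (poly_ring d)"
  by (simp add: Const_def poly_ring_single)

lemma cring_poly_ring: "cring (poly_ring d)"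
proof (rule cringI)
  show "abelian_group (poly_ring d)"
  proof (rule abelian_groupI)
    fix x assume "x \<in> carrier (poly_ring d)"
    then show "\<exists>y\<in>carrier (poly_ring d). y \<oplus>\<^bsub>poly_ring d\<^esub> x = \<zero>\<^bsub>poly_ring d\<^esub>"
      by (intro bexI[of _ "- x"]) (simp_all add: poly_ring_uminus)
  qed (simp_all add: poly_ring_add in_poly_ring[of 0] add.assoc add.commute)
  show "comm_monoid (poly_ring d)"
  proof (rule comm_monoidI)
    show "\<one>\<^bsub>poly_ring d\<^esub> \<in> carrier (poly_ring d)"
      by (simp add: in_poly_ring)
  qed (simp_all add: poly_ring_mult mult.assoc mult.commute)
qed (simp add: distrib_right)

lemma ring_poly_ring: "ring (poly_ring d)"
  by (rule cring.axioms(1)[OF cring_poly_ring])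

lemma poly_ring_a_inv: "p \<in> carrier (poly_ring d) \<Longrightarrow> \<ominus>\<^bsub>poly_ring d\<^esub> p = - p"
proof -
  interpret cring "poly_ring d" by (rule cring_poly_ring)
  assume "p \<in> carrier (poly_ring d)"
  then show ?thesis
    by (intro minus_equality) (simp_all add: poly_ring_uminus)
qed

lemma single_eq_Const_mult: "Poly_Mapping.single t c = Const c * Poly_Mapping.single t 1"
  by (simp add: Const_def mult_single)

lemma lookup_Const_mult: "Poly_Mapping.lookup (Const c * p) t = c * Poly_Mapping.lookup p t"
proof -
  have "Const c * p = Poly_Mapping.map ((*) c) p"
    by (simp add: Const_def mult_map_scale_conv_mult)
  then show ?thesis
    by (simp add: Poly_Mapping.map.rep_eq when_def)
qed

lemma keys_Const_mult: "Poly_Mapping.keys (Const c * p) \<subseteq> Poly_Mapping.keys p"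
  by (auto simp: in_keys_iff lookup_Const_mult)

section \<open>The kernel of the substitution and its identification with the vanishing
  ideal\<close>

definition gamma_kernel :: "nat \<Rightarrow> cpoly set" where
  "gamma_kernel d = {p \<in> carrier (poly_ring d). gamma_map p = 0}"

lemma ideal_gamma_kernel: "ideal (gamma_kernel d) (poly_ring d)"
proof -
  interpret cring "poly_ring d" by (rule cring_poly_ring)
  show ?thesis
  proof (rule idealI)
    show "ring (poly_ring d)" by (rule ring_poly_ring)
    show "subgroup (gamma_kernel d) (add_monoid (poly_ring d))"
    proof (rule add.subgroupI)
      show "gamma_kernel d \<noteq> {}"
        using gamma_map_simps by (auto simp: gamma_kernel_def in_poly_ring intro!: exI[of _ 0])
    qed (auto simp: gamma_kernel_def poly_ring_add poly_ring_uminus poly_ring_a_inv gamma_map_simps)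
  qed (auto simp: gamma_kernel_def poly_ring_mult gamma_map_simps)
qed

text \<open>The target \<open>complex poly poly poly\<close> is an integral domain, and
  \<open>1\<close> is not mapped to \<open>0\<close>.\<close>

lemma primeideal_gamma_kernel: "primeideal (gamma_kernel d) (poly_ring d)"
proof (rule primeidealI[OF ideal_gamma_kernel cring_poly_ring])
  have "1 \<in> carrier (poly_ring d)" "1 \<notin> gamma_kernel d"
    by (simp_all add: in_poly_ring gamma_kernel_def gamma_map_simps)
  then show "carrier (poly_ring d) \<noteq> gamma_kernel d" by blast
qed (auto simp: gamma_kernel_def gamma_map_simps)

lemma hom_component_kernel:
  "p \<in> gamma_kernel d \<Longrightarrow> hom_component n p \<in> gamma_kernel d"
  by (auto simp: gamma_kernel_def in_poly_ring keys_hom_component gamma_map_hom_component)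

text \<open>Taking the closure changes no vanishing condition: the parametrized points lie in their
  closure, and conversely the zero locus of a homogeneous \<open>f\<close> vanishing on them is one
  of the sets being intersected.\<close>

lemma vanishes_on_gamma_variety:
  assumes f: "f \<in> homogeneous_polys d"
  shows "(\<forall>P\<in>gamma_moment_variety d. vanishes_at f P) \<longleftrightarrow> gamma_map f = 0"
proof
  let ?X = "{proj_point (vec (d + 1) (gamma_moment k \<theta>)) |k \<theta>. True}"
  have keys: "Poly_Mapping.keys f \<subseteq> monomials d"
    using f by (auto simp: homogeneous_polys_def graded_piece_def in_poly_ring)
  {
    assume *: "\<forall>P\<in>gamma_moment_variety d. vanishes_at f P"
    show "gamma_map f = 0"
    proof (rule gamma_map_eq_0I)
      fix s \<theta> k :: complex
      assume s: "s \<noteq> 0"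
      have "proj_point (vec (d + 1) (gamma_moment k \<theta>)) \<in> gamma_moment_variety d"
        unfolding gamma_moment_variety_def zariski_closure_def by blast
      with * have "vanishes_at f (proj_point (vec (d + 1) (gamma_moment k \<theta>)))"
        by (rule bspec)
      moreover have "s \<cdot>\<^sub>v vec (d + 1) (gamma_moment k \<theta>) \<in> proj_point (vec (d + 1) (gamma_moment k \<theta>))"
        unfolding proj_point_def using s by blast
      ultimately have "poly_eval f (s \<cdot>\<^sub>v vec (d + 1) (gamma_moment k \<theta>)) = 0"
        unfolding vanishes_at_def by (rule bspec)
      then show "poly (poly (poly (gamma_map f) [:[:s:]:]) [:\<theta>:]) k = 0"
        by (simp only: poly_eval_gamma[OF keys])
    qed
  }
  {
    assume *: "gamma_map f = 0"
    have "?X \<subseteq> zero_locus d {f}"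
    proof
      fix P assume "P \<in> ?X"
      then obtain k \<theta> where P: "P = proj_point (vec (d + 1) (gamma_moment k \<theta>))" by blast
      \<comment> \<open>The moment \<open>m_0 = 1\<close> keeps the coordinate vector nonzero, so it
        defines a projective point.\<close>
      have "vec (d + 1) (gamma_moment k \<theta>) $ 0 \<noteq> 0\<^sub>v (d + 1) $ 0"
        by (simp add: gamma_moment_def)
      then have "vec (d + 1) (gamma_moment k \<theta>) \<noteq> 0\<^sub>v (d + 1)"
        by (rule contrapos_nn) (rule arg_cong)
      then have "P \<in> proj_space d"
        unfolding proj_space_def P by (intro imageI) simp
      moreover have "vanishes_at f P"
        unfolding vanishes_at_def P proj_point_def
        using poly_eval_gamma[OF keys, of _ k \<theta>] * by auto
      ultimately show "P \<in> zero_locus d {f}"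
        by (simp add: zero_locus_def)
    qed
    then have "gamma_moment_variety d \<subseteq> zero_locus d {f}"
      unfolding gamma_moment_variety_def zariski_closure_def using f by (intro Inter_lower) blast
    then show "\<forall>P\<in>gamma_moment_variety d. vanishes_at f P"
      by (auto simp: zero_locus_def)
  }
qed

text \<open>By \<open>vanishes_on_gamma_variety\<close> the generators of \<open>gamma_ideal\<close>
  are the homogeneous elements of the kernel. They generate all of it because every element of the
  kernel is the sum of its homogeneous components, which lie in the kernel again.\<close>

lemma gamma_ideal_eq_kernel: "gamma_ideal d = gamma_kernel d"
proof -
  interpret cring "poly_ring d" by (rule cring_poly_ring)
  define F where "F = {f \<in> homogeneous_polys d. gamma_map f = 0}"
  have carr: "F \<subseteq> carrier (poly_ring d)"
    by (auto simp: F_def homogeneous_polys_def graded_piece_def)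
  have eq: "gamma_ideal d = genideal (poly_ring d) F"
    unfolding gamma_ideal_def vanishing_ideal_def F_def
    using vanishes_on_gamma_variety by (intro arg_cong[of _ _ "genideal (poly_ring d)"]) blast
  have "genideal (poly_ring d) F \<subseteq> gamma_kernel d"
    using carr by (intro genideal_minimal ideal_gamma_kernel) (auto simp: gamma_kernel_def F_def)
  moreover have "p \<in> genideal (poly_ring d) F" if p: "p \<in> gamma_kernel d" for p
  proof -
    interpret J: ideal "genideal (poly_ring d) F" "poly_ring d"
      by (rule genideal_ideal[OF carr])
    have "hom_component n p \<in> F" for n
    proof -
      have "hom_component n p \<in> gamma_kernel d"
        by (rule hom_component_kernel[OF p])
      moreover from this have "hom_component n p \<in> graded_piece d n"
        by (simp add: gamma_kernel_def graded_piece_def keys_hom_component)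
      ultimately show ?thesis
        unfolding F_def homogeneous_polys_def gamma_kernel_def by blast
    qed
    then have comp: "hom_component n p \<in> genideal (poly_ring d) F" for n
      using genideal_self[OF carr] by blast
    have "(\<Sum>n\<in>A. hom_component n p) \<in> genideal (poly_ring d) F" for A
    proof (induction A rule: infinite_finite_induct)
      case (insert n A)
      then show ?case
        using J.a_closed[OF comp, of "\<Sum>n\<in>A. hom_component n p" n] by simp
    qed (use J.zero_closed in simp_all)
    then show ?thesis
      by (subst sum_hom_component)
  qed
  ultimately show ?thesis
    unfolding eq by blast
qed

section \<open>The minors\<close>

lemma det_2x2:
  assumes "A \<in> carrier_mat 2 2"
  shows "det A = A $$ (0,0) * A $$ (1,1) - A $$ (0,1) * A $$ (1,0)"
  using assms
  by (subst laplace_expansion_row[OF assms, of 0])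
    (auto simp: cofactor_def mat_delete_def det_single numeral_2_eq_2 lessThan_Suc)

lemma det_3x3:
  assumes "A \<in> carrier_mat 3 3"
  shows "det A = A $$ (0,0) * (A $$ (1,1) * A $$ (2,2) - A $$ (1,2) * A $$ (2,1))
    - A $$ (0,1) * (A $$ (1,0) * A $$ (2,2) - A $$ (1,2) * A $$ (2,0))
    + A $$ (0,2) * (A $$ (1,0) * A $$ (2,1) - A $$ (1,1) * A $$ (2,0))"
proof -
  have [simp]: "dim_row A = 3" "dim_col A = 3" using assms by auto
  have carr: "mat_delete A 0 j \<in> carrier_mat 2 2" for j
    by (simp add: mat_delete_def)
  have "{..<3::nat} = {0, 1, 2}" by auto
  then show ?thesis
    by (subst laplace_expansion_row[OF assms, of 0])
      (simp_all add: cofactor_def det_2x2[OF carr], simp_all add: mat_delete_def numeral_2_eq_2 algebra_simps)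
qed

text \<open>The first two rows carry the same variable in each column, up to a scalar, so the six
  terms of the determinant share three monomials in pairs. Their coefficients combine to differences
  of column indices.\<close>

lemma col_minor_gamma:
  assumes "i < j" "j < k" "k < d"
  shows "col_minor (gamma_matrix d) i j k =
    Poly_Mapping.single (minor_lead i j k) (of_nat j - of_nat k) +
    Poly_Mapping.single (minor_lead j i k) (of_nat k - of_nat i) +
    Poly_Mapping.single (minor_lead k i j) (of_nat i - of_nat j)"
proof -
  define x y where "x = Var" and "y = (\<lambda>i. Var (i + 1))"
  have lead: "Poly_Mapping.single (minor_lead a b c) (of_nat m - of_nat n) =
      y a * x b * x c * (of_nat m - of_nat n)" for a b c m n
    by (simp add: minor_lead_def x_def y_def Var_def mult_single single_diff[symmetric] single_of_nat[symmetric]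
        del: single_of_nat)
  have "col_minor (gamma_matrix d) i j k =
     of_nat i * x i * (x j * y k - x k * y j) - of_nat j * x j * (x i * y k - x k * y i)
     + of_nat k * x k * (x i * y j - x j * y i)"
    unfolding col_minor_def using assms
    by (subst det_3x3) (simp_all add: gamma_matrix_def x_def y_def)
  also have "\<dots> = y i * x j * x k * (of_nat j - of_nat k) + y j * x i * x k * (of_nat k - of_nat i) +
      y k * x i * x j * (of_nat i - of_nat j)"
    by (simp add: algebra_simps)
  finally show ?thesis
    by (simp only: lead)
qed

lemma mono_deg_minor_lead [simp]: "mono_deg (minor_lead i j k) = 3"
  by (simp add: minor_lead_def mono_deg_add)

lemma minor_lead_in_monomials: "i < d \<Longrightarrow> j < d \<Longrightarrow> k < d \<Longrightarrow> minor_lead i j k \<in> monomials d"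
  by (simp add: minor_lead_def monomials_add_iff monomials_single_iff)

text \<open>Since \<open>rising (a + 1) = rising a * [:of_nat a, 1:]\<close>, the three images share
  the factor \<open>rising i * rising j * rising k\<close>. What remains is the identity
  \<open>(y - z) (T + x) + (z - x) (T + y) + (x - y) (T + z) = 0\<close>.\<close>

lemma gamma_map_minor:
  assumes "i < j" "j < k" "k < d"
  shows "gamma_map (col_minor (gamma_matrix d) i j k) = 0"
proof -
  have rs: "rising (Suc i) = rising i * [:of_nat i, 1:]" for i
    by (simp add: rising_def mult.commute)
  have K: "mono_eval rising (minor_lead a b c) = rising a * rising b * rising c * [:of_nat a, 1:]" for a b c
    by (simp add: minor_lead_def mono_eval_add rs algebra_simps)
  have w: "mono_weight (minor_lead a b c) = a + b + c + 1" for a b c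
    by (simp add: minor_lead_def mono_weight_add)
  have zero: "smult (y - z) (R * [:x, 1:]) + smult (z - x) (R * [:y, 1:]) + smult (x - y) (R * [:z, 1:]) = 0"
    for x y z :: complex and R
  proof -
    have "smult (y - z) (R * [:x, 1:]) + smult (z - x) (R * [:y, 1:]) + smult (x - y) (R * [:z, 1:])
      = R * (smult (y - z) [:x, 1:] + smult (z - x) [:y, 1:] + smult (x - y) [:z, 1:])"
      by (simp only: distrib_left mult_smult_right)
    also have "smult (y - z) [:x, 1:] + smult (z - x) [:y, 1:] + smult (x - y) [:z, 1:] = 0"
      by (simp add: algebra_simps)
    finally show ?thesis by simp
  qed
  have "rising j * rising i * rising k = rising i * rising j * rising k"
    "rising k * rising i * rising j = rising i * rising j * rising k"
    "j + i + k + 1 = i + j + k + 1" "k + i + j + 1 = i + j + k + 1"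
    by (simp_all add: ac_simps)
  then show ?thesis
    unfolding col_minor_gamma[OF assms] gamma_map_simps gamma_map_single K w mono_deg_minor_lead
    by (simp only: add_monom zero monom_eq_0)
qed

text \<open>All monomials of a minor have the same weight, and the antidiagonal one has the least sum of
  squared indices. This gives a terminating reduction without reference to a term order.\<close>

definition mono_sq :: "mono \<Rightarrow> nat" where
  "mono_sq t = (\<Sum>i\<in>Poly_Mapping.keys t. i\<^sup>2 * Poly_Mapping.lookup t i)"

lemma mono_sq_add: "mono_sq (s + t) = mono_sq s + mono_sq t"
  unfolding mono_sq_def by (rule setsum_keys_plus_distrib) (auto simp: distrib_left)

lemma mono_sq_minor_lead: "mono_sq (minor_lead i j k) = i\<^sup>2 + j\<^sup>2 + k\<^sup>2 + 2 * i + 1"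
  by (simp add: minor_lead_def mono_sq_add) (simp add: mono_sq_def power2_eq_square)

text \<open>In a fixed degree \<open>mono_sq\<close> is bounded, so rewriting steps that increase it
  must stop.\<close>

lemma mono_sq_le:
  assumes "t \<in> monomials d"
  shows "mono_sq t \<le> mono_deg t * d\<^sup>2"
proof -
  have "i\<^sup>2 * Poly_Mapping.lookup t i \<le> Poly_Mapping.lookup t i * d\<^sup>2" if "i \<in> Poly_Mapping.keys t" for i
    using assms that by (auto simp: monomials_def intro!: power_mono)
  then show ?thesis
    unfolding mono_sq_def mono_deg_def sum_distrib_right by (rule sum_mono)
qed

text \<open>\<open>mono_sq\<close> tells the three monomials apart, since it reveals which column
  index was raised by one; their coefficients are nonzero because the columns are distinct.\<close>

lemma keys_col_minor:
  assumes "i < j" "j < k" "k < d"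
  shows "Poly_Mapping.keys (col_minor (gamma_matrix d) i j k) =
    {minor_lead i j k, minor_lead j i k, minor_lead k i j}"
proof -
  have "minor_lead i j k \<noteq> minor_lead j i k" "minor_lead i j k \<noteq> minor_lead k i j"
    "minor_lead j i k \<noteq> minor_lead k i j"
    using assms by (auto dest!: arg_cong[of _ _ mono_sq] simp: mono_sq_minor_lead)
  then show ?thesis
    using assms unfolding col_minor_gamma[OF assms]
    by (auto simp: in_keys_iff lookup_add lookup_single when_def split: if_splits)
qed

section \<open>Reduction to standard monomials\<close>

text \<open>Modulo the kernel, each minor rewrites its antidiagonal monomial into the other two, and
  well-founded induction along \<open>R\<close> finishes the reduction. \<open>R\<close> is left
  open because it is instantiated twice: by increasing \<open>mono_sq\<close> for spanning, and by a
  term order, where the bound \<open>(s, t) \<in> R\<close> on the result matters. Degree is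
  preserved, so \<open>dec\<close> only concerns degree \<open>n\<close>.\<close>

lemma reduce_to_std:
  assumes d: "2 \<le> d" and wf: "wf R" and trans: "trans R"
    and dec: "\<And>i j k u. i < j \<Longrightarrow> j < k \<Longrightarrow> k < d \<Longrightarrow> u \<in> monomials d \<Longrightarrow> mono_deg u + 3 = n \<Longrightarrow>
      (u + minor_lead j i k, u + minor_lead i j k) \<in> R \<and> (u + minor_lead k i j, u + minor_lead i j k) \<in> R"
    and t: "t \<in> monomials d" "mono_deg t = n"
  shows "\<exists>p. Poly_Mapping.keys p \<subseteq> std_mono d ` std_index d n \<inter> {s. s = t \<or> (s, t) \<in> R} \<and>
    gamma_map p = gamma_map (Poly_Mapping.single t 1)"
  using wf t
proof (induction t rule: wf_induct_rule)
  case (less t)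
  consider "t \<in> std_mono d ` std_index d n"
    | i j k u where "i < j" "j < k" "k < d" "t = u + minor_lead i j k"
    using std_or_lead[OF less.prems(1) d] less.prems(2) by blast
  then show ?case
  proof cases
    case 1
    then show ?thesis
      by (intro exI[of _ "Poly_Mapping.single t 1"]) simp
  next
    case 2
    let ?s1 = "u + minor_lead j i k" and ?s2 = "u + minor_lead k i j"
    have u: "u \<in> monomials d" "mono_deg u + 3 = n"
      using less.prems 2 by (simp_all add: monomials_add_iff mono_deg_add)
    have s: "(?s1, t) \<in> R" "(?s2, t) \<in> R"
      using dec[OF 2(1-3) u] 2(4) by simp_all
    have mon: "?s1 \<in> monomials d" "?s2 \<in> monomials d" "mono_deg ?s1 = n" "mono_deg ?s2 = n"
      using u 2 by (simp_all add: monomials_add_iff mono_deg_add minor_lead_in_monomials)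
    obtain p1 where p1: "Poly_Mapping.keys p1 \<subseteq> std_mono d ` std_index d n \<inter> {s. s = ?s1 \<or> (s, ?s1) \<in> R}"
        "gamma_map p1 = gamma_map (Poly_Mapping.single ?s1 1)"
      using less.IH[OF s(1) mon(1,3)] by blast
    obtain p2 where p2: "Poly_Mapping.keys p2 \<subseteq> std_mono d ` std_index d n \<inter> {s. s = ?s2 \<or> (s, ?s2) \<in> R}"
        "gamma_map p2 = gamma_map (Poly_Mapping.single ?s2 1)"
      using less.IH[OF s(2) mon(2,4)] by blast
    \<comment> \<open>These coefficients come from solving the minor for its antidiagonal term, that
      is, from dividing by \<open>of_nat k - of_nat j\<close>.\<close>
    define \<alpha> \<beta> :: complex where
      "\<alpha> = (of_nat k - of_nat i) / (of_nat k - of_nat j)" and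
      "\<beta> = (of_nat i - of_nat j) / (of_nat k - of_nat j)"
    define p where "p = Const \<alpha> * p1 + Const \<beta> * p2"
    have "Poly_Mapping.keys p \<subseteq> Poly_Mapping.keys p1 \<union> Poly_Mapping.keys p2"
      unfolding p_def by (rule order_trans[OF Poly_Mapping.keys_add Un_mono[OF keys_Const_mult keys_Const_mult]])
    also have "\<dots> \<subseteq> std_mono d ` std_index d n \<inter> {s. s = t \<or> (s, t) \<in> R}"
    proof -
      have "{r. r = ?s1 \<or> (r, ?s1) \<in> R} \<subseteq> {r. r = t \<or> (r, t) \<in> R}"
        "{r. r = ?s2 \<or> (r, ?s2) \<in> R} \<subseteq> {r. r = t \<or> (r, t) \<in> R}"
        using s transD[OF trans] by auto
      then show ?thesis
        using p1(1) p2(1) by (meson Un_least Int_mono order_refl order_trans)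
    qed
    finally have keys: "Poly_Mapping.keys p \<subseteq> \<dots>" .
    have kj: "(of_nat k - of_nat j :: complex) \<noteq> 0"
      using 2 by simp
    let ?M = "col_minor (gamma_matrix d) i j k"
    have "Const (1 / (of_nat k - of_nat j)) * (Poly_Mapping.single u 1 * ?M) =
        Const \<alpha> * Poly_Mapping.single ?s1 1 + Const \<beta> * Poly_Mapping.single ?s2 1 - Poly_Mapping.single t 1"
    proof -
      have "(of_nat j - of_nat k) / (of_nat k - of_nat j) = (-1 :: complex)"
        using kj by (simp add: field_simps)
      then show ?thesis
        unfolding col_minor_gamma[OF 2(1-3)] 2(4)
        by (simp add: Const_def distrib_left mult_single \<alpha>_def \<beta>_def single_uminus)
    qed
    from arg_cong[OF this, of gamma_map]
    have "gamma_map p = gamma_map (Poly_Mapping.single t 1)"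
      unfolding p_def gamma_map_simps gamma_map_minor[OF 2(1-3)] p1(2) p2(2) by simp
    with keys show ?thesis by blast
  qed
qed

lemma reduce_poly_to_std:
  assumes d: "2 \<le> d" and p: "p \<in> graded_piece d n"
  obtains q where "Poly_Mapping.keys q \<subseteq> std_mono d ` std_index d n" "gamma_map q = gamma_map p"
proof -
  define R where "R = {(s, t). s \<in> monomials d \<and> mono_deg s = n \<and> mono_sq t < mono_sq s}"
  \<comment> \<open>The truncated subtraction decreases strictly, because
    \<open>mono_sq t < mono_sq s\<close> and \<open>mono_sq s\<close> is at most
    \<open>n * d\<^sup>2\<close>.\<close>
  have "R \<subseteq> measure (\<lambda>t. n * d\<^sup>2 - mono_sq t)"
    unfolding R_def using mono_sq_le by fastforce
  then have wf: "wf R"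
    using wf_subset by blast
  have trans: "trans R"
    by (auto simp: R_def trans_def)
  have "\<exists>q. Poly_Mapping.keys q \<subseteq> std_mono d ` std_index d n \<and>
      gamma_map q = gamma_map (Poly_Mapping.single t 1)" if t: "t \<in> Poly_Mapping.keys p" for t
  proof -
    have "\<exists>q. Poly_Mapping.keys q \<subseteq> std_mono d ` std_index d n \<inter> {s. s = t \<or> (s, t) \<in> R} \<and>
      gamma_map q = gamma_map (Poly_Mapping.single t 1)"
    proof (rule reduce_to_std[OF d wf trans])
      show "t \<in> monomials d" "mono_deg t = n"
        using t p by (auto simp: graded_piece_def in_poly_ring)
    qed (auto simp: R_def monomials_add_iff minor_lead_in_monomials mono_deg_add mono_sq_add mono_sq_minor_lead)
    then show ?thesis by blast
  qed
  then have "\<forall>t\<in>Poly_Mapping.keys p. \<exists>q. Poly_Mapping.keys q \<subseteq> std_mono d ` std_index d n \<and>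
      gamma_map q = gamma_map (Poly_Mapping.single t 1)"
    by (rule ballI)
  from bchoice[OF this] obtain Q where
    Q: "\<forall>t\<in>Poly_Mapping.keys p. Poly_Mapping.keys (Q t) \<subseteq> std_mono d ` std_index d n \<and>
      gamma_map (Q t) = gamma_map (Poly_Mapping.single t 1)" ..
  define q where "q = (\<Sum>t\<in>Poly_Mapping.keys p. Const (Poly_Mapping.lookup p t) * Q t)"
  show ?thesis
  proof
    have "Poly_Mapping.keys q \<subseteq> (\<Union>t\<in>Poly_Mapping.keys p. Poly_Mapping.keys (Q t))"
      unfolding q_def by (rule order_trans[OF keys_sum UN_mono[OF order_refl keys_Const_mult]])
    then show "Poly_Mapping.keys q \<subseteq> std_mono d ` std_index d n"
      using Q by blast
    have "gamma_map p = gamma_map (\<Sum>t\<in>Poly_Mapping.keys p. Const (Poly_Mapping.lookup p t) * Poly_Mapping.single t 1)"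
      by (subst poly_mapping_eq_sum_single[of p]) (simp only: single_eq_Const_mult[symmetric])
    then show "gamma_map q = gamma_map p"
      unfolding q_def gamma_map_simps by (simp add: Q)
  qed
qed

section \<open>Groebner bases\<close>

text \<open>A finite nonempty set has a greatest element in a linear order, unique by antisymmetry,
  so the description in \<open>init_mono\<close> denotes it.\<close>

lemma init_mono_max:
  assumes r: "term_order d r" and p: "p \<in> carrier (poly_ring d)" "p \<noteq> 0"
  shows "init_mono r p \<in> Poly_Mapping.keys p" "\<And>s. s \<in> Poly_Mapping.keys p \<Longrightarrow> (s, init_mono r p) \<in> r"
proof -
  have lin: "linear_order_on (monomials d) r"
    using r by (simp add: term_order_def)
  have refl: "(a, a) \<in> r" if "a \<in> monomials d" for a
    using lin that by (auto simp: order_on_defs refl_on_def)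
  have total: "(a, b) \<in> r \<or> (b, a) \<in> r" if "a \<in> monomials d" "b \<in> monomials d" for a b
    using lin that refl by (cases "a = b") (auto simp: order_on_defs total_on_def)
  have trans: "trans r" and antisym: "antisym r"
    using lin by (auto simp: order_on_defs)
  have "\<exists>t\<in>A. \<forall>s\<in>A. (s, t) \<in> r" if "finite A" "A \<noteq> {}" "A \<subseteq> monomials d" for A
    using that
  proof (induction A rule: finite_ne_induct)
    case (singleton x)
    then show ?case using refl by simp
  next
    case (insert x A)
    then obtain t where t: "t \<in> A" "\<forall>s\<in>A. (s, t) \<in> r" by auto
    show ?case
    proof (cases "(x, t) \<in> r")
      case True
      then show ?thesis using t by blast
    next
      case False
      then have "(t, x) \<in> r" using total[of x t] t insert.prems by blast
      then have "\<forall>s\<in>insert x A. (s, x) \<in> r"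
        using t(2) transD[OF trans] refl insert.prems by blast
      then show ?thesis by blast
    qed
  qed
  from this[of "Poly_Mapping.keys p"] obtain t where
    t: "t \<in> Poly_Mapping.keys p \<and> (\<forall>s\<in>Poly_Mapping.keys p. (s, t) \<in> r)"
    using p by (auto simp: in_poly_ring)
  then have "init_mono r p = t"
    unfolding init_mono_def using antisymD[OF antisym] by (intro the_equality) blast+
  with t show "init_mono r p \<in> Poly_Mapping.keys p" "\<And>s. s \<in> Poly_Mapping.keys p \<Longrightarrow> (s, init_mono r p) \<in> r"
    by auto
qed

text \<open>With finitely many monomials in each degree, the strict part of a term order restricted
  to one degree is well-founded.\<close>

lemma finite_monomials_deg: "finite {t \<in> monomials d. mono_deg t = n}"
proof (rule finite_imageD)
  have "Poly_Mapping.lookup t i \<le> n" if "t \<in> monomials d" "mono_deg t = n" for t i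
  proof (cases "i \<in> Poly_Mapping.keys t")
    case True
    then show ?thesis
      using that member_le_sum[OF True, of "Poly_Mapping.lookup t"] by (simp add: mono_deg_def)
  qed (simp add: in_keys_iff)
  moreover have "Poly_Mapping.lookup t i = 0" if "t \<in> monomials d" "i \<notin> {..d}" for t i
    using that by (auto simp: monomials_def in_keys_iff subset_iff)
  ultimately have "Poly_Mapping.lookup ` {t \<in> monomials d. mono_deg t = n} \<subseteq>
      {f. \<forall>i. (i \<in> {..d} \<longrightarrow> f i \<in> {..n}) \<and> (i \<notin> {..d} \<longrightarrow> f i = 0)}"
    by auto
  then show "finite (Poly_Mapping.lookup ` {t \<in> monomials d. mono_deg t = n})"
    by (rule finite_subset) (rule finite_set_of_finite_funs; simp)
  show "inj_on Poly_Mapping.lookup {t \<in> monomials d. mono_deg t = n}"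
    by (rule inj_onI) (simp only: poly_mapping_eq_iff)
qed

text \<open>The order determines the initial monomial up to a scalar, and comparing supports removes
  the scalar. The entry of the first row contributes \<open>of_nat k\<close>, which is nonzero since
  \<open>i < j < k\<close>.\<close>

lemma init_mono_minor:
  assumes r: "antidiagonal_term_order d (gamma_matrix d) r" and ijk: "i < j" "j < k" "k < d"
  shows "init_mono r (col_minor (gamma_matrix d) i j k) = minor_lead i j k"
proof -
  let ?t = "init_mono r (col_minor (gamma_matrix d) i j k)"
  have "\<forall>i j k. i < j \<and> j < k \<and> k < d \<longrightarrow> (\<exists>c. c \<noteq> 0 \<and>
      Const c * Poly_Mapping.single (init_mono r (col_minor (gamma_matrix d) i j k)) 1 =
      gamma_matrix d $$ (2, i) * gamma_matrix d $$ (1, j) * gamma_matrix d $$ (0, k))"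
    using r unfolding antidiagonal_term_order_def by (simp add: gamma_matrix_def)
  then obtain c where c: "c \<noteq> 0" "Const c * Poly_Mapping.single ?t 1 =
      gamma_matrix d $$ (2, i) * gamma_matrix d $$ (1, j) * gamma_matrix d $$ (0, k)"
    using ijk by blast
  have "gamma_matrix d $$ (2, i) * gamma_matrix d $$ (1, j) * gamma_matrix d $$ (0, k) =
      Var (i + 1) * Var j * Var k * of_nat k"
    using ijk by (simp add: gamma_matrix_def mult_ac)
  also have "\<dots> = Poly_Mapping.single (minor_lead i j k) (of_nat k)"
    by (simp add: minor_lead_def Var_def mult_single single_of_nat[symmetric] del: single_of_nat)
  finally have "Poly_Mapping.single ?t c = Poly_Mapping.single (minor_lead i j k) (of_nat k)"
    using c(2) by (simp add: Const_def mult_single)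
  from arg_cong[OF this, of Poly_Mapping.keys] show ?thesis
    using c(1) ijk by simp
qed

text \<open>Otherwise the initial monomial \<open>t\<close> is standard. Reducing the remaining
  terms of the same degree to standard monomials below \<open>t\<close> leaves a relation in which
  \<open>t\<close> keeps its nonzero coefficient, against \<open>std_independent\<close>.\<close>

lemma init_mono_gamma_ideal:
  assumes d: "2 \<le> d" and r: "antidiagonal_term_order d (gamma_matrix d) r"
    and f: "f \<in> gamma_kernel d" "f \<noteq> 0"
  shows "\<exists>i j k u. i < j \<and> j < k \<and> k < d \<and> init_mono r f = u + minor_lead i j k"
proof (rule ccontr)
  assume not_lead: "\<not> ?thesis"
  have to: "term_order d r"
    using r by (simp add: antidiagonal_term_order_def)
  have lin: "linear_order_on (monomials d) r"
    using to by (simp add: term_order_def)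
  have trans_r: "trans r" and antisym: "antisym r"
    using lin by (auto simp: order_on_defs)
  define t where "t = init_mono r f"
  define n where "n = mono_deg t"
  have fc: "f \<in> carrier (poly_ring d)"
    using f by (simp add: gamma_kernel_def)
  have t: "t \<in> Poly_Mapping.keys f" "\<And>s. s \<in> Poly_Mapping.keys f \<Longrightarrow> (s, t) \<in> r"
    using init_mono_max[OF to fc f(2)] by (simp_all add: t_def)
  have tm: "t \<in> monomials d"
    using t(1) fc by (auto simp: in_poly_ring)
  have t_std: "t \<in> std_mono d ` std_index d n"
    using std_or_lead[OF tm d] not_lead unfolding t_def n_def by blast
  define R where "R = {(a, b) \<in> r. a \<noteq> b \<and> mono_deg a = n \<and> mono_deg b = n \<and> a \<in> monomials d \<and> b \<in> monomials d}"
  have trans: "trans R"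
    using transD[OF trans_r] antisymD[OF antisym] unfolding R_def by (intro transI) blast
  have wf: "wf R"
  proof (rule finite_acyclic_wf)
    have "R \<subseteq> {t \<in> monomials d. mono_deg t = n} \<times> {t \<in> monomials d. mono_deg t = n}"
      by (auto simp: R_def)
    then show "finite R"
      by (rule finite_subset) (intro finite_cartesian_product finite_monomials_deg)
    show "acyclic R"
      using trans by (simp add: acyclic_irrefl trancl_id) (auto simp: irrefl_def R_def)
  qed
  have dec: "(u + minor_lead j i k, u + minor_lead i j k) \<in> R \<and> (u + minor_lead k i j, u + minor_lead i j k) \<in> R"
    if ijk: "i < j" "j < k" "k < d" and u: "u \<in> monomials d" "mono_deg u + 3 = n" for i j k u
  proof -
    let ?M = "col_minor (gamma_matrix d) i j k"
    have M: "?M \<in> carrier (poly_ring d)" "?M \<noteq> 0"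
      using keys_col_minor[OF ijk] ijk by (auto simp: in_poly_ring minor_lead_in_monomials)
    have "(minor_lead j i k, minor_lead i j k) \<in> r" "(minor_lead k i j, minor_lead i j k) \<in> r"
      using init_mono_max(2)[OF to M] by (simp_all add: keys_col_minor[OF ijk] init_mono_minor[OF r ijk])
    moreover have "(s + u, t + u) \<in> r" if "(s, t) \<in> r" for s t
      using to that u(1) unfolding term_order_def by blast
    ultimately have "(u + minor_lead j i k, u + minor_lead i j k) \<in> r" "(u + minor_lead k i j, u + minor_lead i j k) \<in> r"
      by (simp_all add: add.commute[of u])
    moreover have "minor_lead j i k \<noteq> minor_lead i j k" "minor_lead k i j \<noteq> minor_lead i j k"
      using ijk by (auto dest!: arg_cong[of _ _ mono_sq] simp: mono_sq_minor_lead)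
    ultimately show ?thesis
      using u ijk by (simp add: R_def mono_deg_add monomials_add_iff minor_lead_in_monomials)
  qed
  \<comment> \<open>\<open>f\<close> need not be homogeneous, so only its component in the degree of
    \<open>t\<close> is used; that component also lies in the kernel.\<close>
  define g where "g = hom_component n f - Poly_Mapping.single t (Poly_Mapping.lookup f t)"
  have lookup_g: "Poly_Mapping.lookup g s = (if mono_deg s = n \<and> s \<noteq> t then Poly_Mapping.lookup f s else 0)" for s
    by (auto simp: g_def lookup_minus lookup_hom_component lookup_single when_def n_def)
  have keys_g: "s \<in> monomials d \<and> mono_deg s = n \<and> (s, t) \<in> R" if "s \<in> Poly_Mapping.keys g" for s
  proof -
    have "s \<in> Poly_Mapping.keys f" "mono_deg s = n" "s \<noteq> t"
      using that by (auto simp: in_keys_iff lookup_g split: if_splits)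
    moreover from this have "s \<in> monomials d"
      using fc by (auto simp: in_poly_ring)
    ultimately show ?thesis
      using t(2) tm by (auto simp: R_def n_def)
  qed
  have "\<forall>s\<in>Poly_Mapping.keys g. \<exists>q. Poly_Mapping.keys q \<subseteq> std_mono d ` std_index d n \<inter> {v. v = s \<or> (v, s) \<in> R} \<and>
      gamma_map q = gamma_map (Poly_Mapping.single s 1)"
    using keys_g by (intro ballI reduce_to_std[OF d wf trans dec]) auto
  from bchoice[OF this] obtain Q where
    Q: "\<forall>s\<in>Poly_Mapping.keys g. Poly_Mapping.keys (Q s) \<subseteq> std_mono d ` std_index d n \<inter> {v. v = s \<or> (v, s) \<in> R} \<and>
      gamma_map (Q s) = gamma_map (Poly_Mapping.single s 1)" ..
  define q where "q = (\<Sum>s\<in>Poly_Mapping.keys g. Const (Poly_Mapping.lookup g s) * Q s)"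
  have "Poly_Mapping.keys q \<subseteq> (\<Union>s\<in>Poly_Mapping.keys g. Poly_Mapping.keys (Q s))"
    unfolding q_def by (rule order_trans[OF keys_sum UN_mono[OF order_refl keys_Const_mult]])
  \<comment> \<open>Reduction of \<open>s\<close> only produces monomials not above
    \<open>s\<close>, and \<open>s\<close> is strictly below \<open>t\<close>, so \<open>t\<close>
    cannot reappear.\<close>
  moreover have "Poly_Mapping.keys (Q s) \<subseteq> std_mono d ` std_index d n - {t}" if s: "s \<in> Poly_Mapping.keys g" for s
  proof -
    have "(t, s) \<notin> R" "s \<noteq> t"
      using keys_g[OF s] antisymD[OF antisym] by (auto simp: R_def)
    then show ?thesis
      using Q s by blast
  qed
  ultimately have keys_q: "Poly_Mapping.keys q \<subseteq> std_mono d ` std_index d n - {t}"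
    by blast
  have "gamma_map g = gamma_map (\<Sum>s\<in>Poly_Mapping.keys g. Const (Poly_Mapping.lookup g s) * Poly_Mapping.single s 1)"
    by (subst poly_mapping_eq_sum_single[of g]) (simp only: single_eq_Const_mult[symmetric])
  then have "gamma_map q = gamma_map g"
    unfolding q_def gamma_map_simps by (simp add: Q)
  then have "gamma_map (q + Poly_Mapping.single t (Poly_Mapping.lookup f t)) = gamma_map (hom_component n f)"
    by (simp add: gamma_map_simps g_def)
  also have "\<dots> = 0"
    using hom_component_kernel[OF f(1)] by (simp add: gamma_kernel_def)
  finally have map0: "gamma_map (q + Poly_Mapping.single t (Poly_Mapping.lookup f t)) = 0" .
  have "Poly_Mapping.keys (q + Poly_Mapping.single t (Poly_Mapping.lookup f t)) \<subseteq> std_mono d ` std_index d n"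
    using Poly_Mapping.keys_add[of q "Poly_Mapping.single t (Poly_Mapping.lookup f t)"] keys_q t_std
    by (auto split: if_splits)
  then have "q + Poly_Mapping.single t (Poly_Mapping.lookup f t) = 0"
    by (intro std_independent[OF d _ map0]) blast
  from arg_cong[OF this, of "\<lambda>p. Poly_Mapping.lookup p t"]
  have "Poly_Mapping.lookup q t + Poly_Mapping.lookup f t = 0"
    by (simp add: lookup_add)
  moreover have "Poly_Mapping.lookup q t = 0"
    using keys_q by (auto simp: in_keys_iff)
  ultimately show False
    using t(1) by (simp add: in_keys_iff)
qed

text \<open>Each initial monomial of the kernel is a monomial multiple of the lead of some minor, so
  the generators of the larger initial ideal already lie in the smaller one.\<close>

lemma groebner_basis_minors:
  assumes d: "2 \<le> d" and r: "antidiagonal_term_order d (gamma_matrix d) r"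
  shows "groebner_basis d r (gamma_kernel d) (minors3 (gamma_matrix d))"
proof -
  interpret cring "poly_ring d" by (rule cring_poly_ring)
  let ?G = "minors3 (gamma_matrix d)"
  have dim: "dim_col (gamma_matrix d) = d"
    by (simp add: gamma_matrix_def)
  have to: "term_order d r"
    using r by (simp add: antidiagonal_term_order_def)
  have fin: "finite ?G"
  proof (rule finite_subset)
    show "?G \<subseteq> (\<lambda>(i, j, k). col_minor (gamma_matrix d) i j k) ` ({..d} \<times> {..d} \<times> {..d})"
    proof
      fix x assume "x \<in> ?G"
      then obtain i j k where "x = col_minor (gamma_matrix d) i j k" "i < j" "j < k" "k < d"
        unfolding minors3_def dim by blast
      then show "x \<in> (\<lambda>(i, j, k). col_minor (gamma_matrix d) i j k) ` ({..d} \<times> {..d} \<times> {..d})"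
        by (intro image_eqI[of _ _ "(i, j, k)"]) simp_all
    qed
  qed simp
  have sub: "?G \<subseteq> gamma_kernel d"
    unfolding minors3_def dim gamma_kernel_def
    by (auto simp: gamma_map_minor in_poly_ring keys_col_minor minor_lead_in_monomials)
  define inits where "inits = (\<lambda>F. {Poly_Mapping.single (init_mono r f) (1::complex) | f. f \<in> F \<and> f \<noteq> 0})"
  have carr: "inits F \<subseteq> carrier (poly_ring d)" if "F \<subseteq> gamma_kernel d" for F
    using that init_mono_max(1)[OF to]
    by (fastforce simp: inits_def gamma_kernel_def in_poly_ring)
  have "inits ?G \<subseteq> inits (gamma_kernel d)"
    using sub by (auto simp: inits_def)
  then have le: "genideal (poly_ring d) (inits ?G) \<subseteq> genideal (poly_ring d) (inits (gamma_kernel d))"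
    using carr by (intro subset_Idl_subset) auto
  interpret J: ideal "genideal (poly_ring d) (inits ?G)" "poly_ring d"
    by (rule genideal_ideal[OF carr[OF sub]])
  have "inits (gamma_kernel d) \<subseteq> genideal (poly_ring d) (inits ?G)"
  proof
    fix x assume "x \<in> inits (gamma_kernel d)"
    then obtain f where f: "f \<in> gamma_kernel d" "f \<noteq> 0" "x = Poly_Mapping.single (init_mono r f) 1"
      by (auto simp: inits_def)
    obtain i j k u where ijk: "i < j" "j < k" "k < d" and u: "init_mono r f = u + minor_lead i j k"
      using init_mono_gamma_ideal[OF d r f(1,2)] by blast
    have "init_mono r f \<in> monomials d"
      using init_mono_max(1)[OF to] f by (auto simp: gamma_kernel_def in_poly_ring)
    then have um: "u \<in> monomials d"
      by (simp add: u monomials_add_iff)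
    have "col_minor (gamma_matrix d) i j k \<in> ?G"
      unfolding minors3_def dim using ijk by blast
    moreover have "col_minor (gamma_matrix d) i j k \<noteq> 0"
      using keys_col_minor[OF ijk] by auto
    ultimately have "Poly_Mapping.single (minor_lead i j k) 1 \<in> inits ?G"
      unfolding inits_def init_mono_minor[OF r ijk, symmetric] by blast
    then have "Poly_Mapping.single (minor_lead i j k) 1 \<in> genideal (poly_ring d) (inits ?G)"
      using genideal_self[OF carr[OF sub]] by blast
    from J.I_l_closed[OF this poly_ring_single[OF um, of 1]]
    show "x \<in> genideal (poly_ring d) (inits ?G)"
      by (simp add: mult_single f(3) u)
  qed
  then have "genideal (poly_ring d) (inits (gamma_kernel d)) \<subseteq> genideal (poly_ring d) (inits ?G)"
    by (intro genideal_minimal J.ideal_axioms)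
  with le fin sub show ?thesis
    unfolding groebner_basis_def init_ideal_def inits_def by blast
qed

section \<open>The Hilbert function\<close>

text \<open>Its image in the quotient is the field of scalars over which
  \<open>hilbert_function\<close> takes dimensions.\<close>

lemma subfield_Const: "subfield (range Const) (poly_ring d)"
proof -
  interpret cring "poly_ring d" by (rule cring_poly_ring)
  have mult: "Const a * Const b = Const (a * b)" for a b
    by (simp add: Const_def mult_single)
  have one: "Const 1 = 1"
    by (simp add: Const_def)
  have zero: "Const a = 0 \<longleftrightarrow> a = 0" for a
    by (metis Const_def lookup_single_eq lookup_zero single_zero)
  show ?thesis
  proof (rule subfieldI)
    show "subcring (range Const) (poly_ring d)"
    proof (rule subcringI', rule subringI)
      show "\<one>\<^bsub>poly_ring d\<^esub> \<in> range Const"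
        using one by (metis poly_ring_simps(2) rangeI)
    next
      fix h assume "h \<in> range Const"
      then obtain c where "h = Const c" by blast
      then have "\<ominus>\<^bsub>poly_ring d\<^esub> h = Const (- c)"
        by (simp add: poly_ring_a_inv poly_ring_Const) (simp add: Const_def single_uminus)
      then show "\<ominus>\<^bsub>poly_ring d\<^esub> h \<in> range Const" by simp
    next
      fix h1 h2 assume "h1 \<in> range Const" "h2 \<in> range Const"
      then obtain a b where h: "h1 = Const a" "h2 = Const b" by blast
      show "h1 \<otimes>\<^bsub>poly_ring d\<^esub> h2 \<in> range Const"
        by (simp add: h mult)
      have "h1 + h2 = Const (a + b)"
        by (simp add: h Const_def single_add)
      then show "h1 \<oplus>\<^bsub>poly_ring d\<^esub> h2 \<in> range Const"
        by simp
    qed (auto simp: poly_ring_Const)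
    show "Units (poly_ring d\<lparr>carrier := range Const\<rparr>) = range Const - {\<zero>\<^bsub>poly_ring d\<^esub>}"
    proof (intro equalityI subsetI)
      fix x assume "x \<in> Units (poly_ring d\<lparr>carrier := range Const\<rparr>)"
      then show "x \<in> range Const - {\<zero>\<^bsub>poly_ring d\<^esub>}"
        by (auto simp: Units_def)
    next
      fix x assume "x \<in> range Const - {\<zero>\<^bsub>poly_ring d\<^esub>}"
      then obtain c where c: "x = Const c" "c \<noteq> 0"
        by (auto simp: zero)
      then have "Const (inverse c) * x = 1" "x * Const (inverse c) = 1"
        by (simp_all add: mult one)
      then show "x \<in> Units (poly_ring d\<lparr>carrier := range Const\<rparr>)"
        using c by (auto simp: Units_def)
    qed
  qed
qed

lemma finite_std_index: "finite (std_index d n)"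
  by (rule finite_subset[of _ "{..d} \<times> {..d} \<times> {..n} \<times> {..n} \<times> {..n}"]) (auto simp: std_index_def)

lemma poly_ring_a_minus:
  assumes "a \<in> carrier (poly_ring d)" "b \<in> carrier (poly_ring d)"
  shows "a \<ominus>\<^bsub>poly_ring d\<^esub> b = a - b"
  by (simp only: a_minus_def poly_ring_a_inv[OF assms(2)] poly_ring_simps add_uminus_conv_diff)

text \<open>The classes of the standard monomials of degree \<open>n\<close> are a basis of that
  piece of the quotient: they span by \<open>reduce_poly_to_std\<close> and are independent by
  \<open>std_independent\<close>.\<close>

lemma hilbert_function_eq:
  assumes d: "2 \<le> d"
  shows "hilbert_function d (gamma_kernel d) n = card (std_index d n)"
proof -
  let ?S = "poly_ring d" and ?I = "gamma_kernel d"
  interpret I: primeideal ?I ?S by (rule primeideal_gamma_kernel)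
  \<comment> \<open>Being a domain, the quotient is nonzero, which is what makes the image of the
    constants a subfield.\<close>
  interpret Q: domain "?S Quot ?I" by (rule I.quotient_is_domain)
  interpret h: ring_hom_ring ?S "?S Quot ?I" "(+>\<^bsub>?S\<^esub>) ?I" by (rule I.rcos_ring_hom_ring)
  define q where "q = (\<lambda>p. ?I +>\<^bsub>?S\<^esub> p)"
  define K where "K = q ` range Const"
  have K: "subfield K (?S Quot ?I)"
    unfolding K_def q_def by (rule h.img_is_subfield(2)[OF subfield_Const Q.one_not_zero])
  have q_eq: "gamma_map a = gamma_map b" if "q a = q b" "a \<in> carrier ?S" "b \<in> carrier ?S" for a b
  proof -
    have "a \<ominus>\<^bsub>?S\<^esub> b \<in> ?I"
      using I.quotient_eq_iff_same_a_r_cos[OF I.is_ideal that(2,3)] that(1) unfolding q_def by (rule iffD2)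
    then have "gamma_map (a - b) = 0"
      unfolding poly_ring_a_minus[OF that(2,3)] gamma_kernel_def by blast
    then show ?thesis
      by (simp only: gamma_map_simps right_minus_eq)
  qed
  have q_eqI: "q a = q b" if "gamma_map a = gamma_map b" "a \<in> carrier ?S" "b \<in> carrier ?S" for a b
  proof -
    have "a \<ominus>\<^bsub>?S\<^esub> b \<in> ?I"
      unfolding poly_ring_a_minus[OF that(2,3)] gamma_kernel_def mem_Collect_eq
    proof
      show "a - b \<in> carrier ?S"
        by (rule poly_ring_diff[OF that(2,3)])
      show "gamma_map (a - b) = 0"
        by (simp only: gamma_map_simps that(1) diff_self)
    qed
    then show ?thesis
      unfolding q_def by (rule iffD1[OF I.quotient_eq_iff_same_a_r_cos[OF I.is_ideal that(2,3)]])
  qed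
  have hom: "q (Const c) \<otimes>\<^bsub>?S Quot ?I\<^esub> q s \<oplus>\<^bsub>?S Quot ?I\<^esub> q p = q (Const c * s + p)"
    if "s \<in> carrier ?S" "p \<in> carrier ?S" for c s p
    using that poly_ring_Const[of c d] poly_ring_mult[OF poly_ring_Const that(1), of c]
      h.hom_add[of "Const c * s" p] h.hom_mult[of "Const c" s]
    by (simp add: q_def)
  define B where "B = map (\<lambda>t. q (Poly_Mapping.single t 1))"
  \<comment> \<open>Linear combinations of classes of monomials are the classes of polynomials
    supported on these monomials, so membership in a span becomes a statement about
    \<open>gamma_map\<close>.\<close>
  have Span: "Q.Span K (B ts) = q ` {p. Poly_Mapping.keys p \<subseteq> set ts}" if "set ts \<subseteq> monomials d" for ts
    using that
  proof (induction ts)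
    case Nil
    then show ?case
      using h.hom_zero by (simp add: B_def q_def)
  next
    case (Cons t ts)
    let ?P = "{p. Poly_Mapping.keys p \<subseteq> set ts}"
    have carr: "p \<in> carrier ?S" if "p \<in> ?P" for p
      using that Cons.prems by (auto simp: in_poly_ring)
    have tc: "Poly_Mapping.single t 1 \<in> carrier ?S"
      using Cons.prems by (simp add: poly_ring_single)
    have "Q.Span K (B (t # ts)) = Q.line_extension K (q (Poly_Mapping.single t 1)) (q ` ?P)"
      using Cons by (simp add: B_def)
    also have "\<dots> = {q (Const c * Poly_Mapping.single t 1 + p) | c p. p \<in> ?P}"
      (is "?L = ?R")
    proof (intro equalityI subsetI)
      fix u assume "u \<in> ?L"
      then obtain c p where "p \<in> ?P"
        "u = q (Const c) \<otimes>\<^bsub>?S Quot ?I\<^esub> q (Poly_Mapping.single t 1) \<oplus>\<^bsub>?S Quot ?I\<^esub> q p"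
        unfolding Q.line_extension_mem_iff K_def by blast
      then show "u \<in> ?R"
        using hom[OF tc carr] by blast
    next
      fix u assume "u \<in> ?R"
      then obtain c p where "p \<in> ?P"
        "u = q (Const c) \<otimes>\<^bsub>?S Quot ?I\<^esub> q (Poly_Mapping.single t 1) \<oplus>\<^bsub>?S Quot ?I\<^esub> q p"
        using hom[OF tc carr] by auto
      then show "u \<in> ?L"
        unfolding Q.line_extension_mem_iff K_def by blast
    qed
    also have "\<dots> = q ` {p. Poly_Mapping.keys p \<subseteq> set (t # ts)}"
    proof (intro equalityI subsetI)
      fix u assume "u \<in> ?R"
      then obtain c p where u: "p \<in> ?P" "u = q (Const c * Poly_Mapping.single t 1 + p)" by blast
      have "Poly_Mapping.keys (Const c * Poly_Mapping.single t 1 + p) \<subseteq> set (t # ts)"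
        using Poly_Mapping.keys_add[of "Const c * Poly_Mapping.single t 1" p] keys_Const_mult[of c "Poly_Mapping.single t 1"] u(1)
        by (auto simp: subset_iff)
      then show "u \<in> q ` {p. Poly_Mapping.keys p \<subseteq> set (t # ts)}"
        using u(2) by blast
    next
      fix u assume "u \<in> q ` {p. Poly_Mapping.keys p \<subseteq> set (t # ts)}"
      then obtain p where p: "Poly_Mapping.keys p \<subseteq> set (t # ts)" "u = q p" by blast
      define p' where "p' = p - Poly_Mapping.single t (Poly_Mapping.lookup p t)"
      have "Poly_Mapping.keys p' \<subseteq> set ts"
        using p(1) by (auto simp: p'_def in_keys_iff lookup_minus lookup_single when_def subset_iff split: if_splits)
      moreover have "u = q (Const (Poly_Mapping.lookup p t) * Poly_Mapping.single t 1 + p')"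
        unfolding p(2) by (rule arg_cong[of _ _ q]) (simp add: single_eq_Const_mult[symmetric] p'_def)
      ultimately show "u \<in> ?R"
        by blast
    qed
    finally show ?case .
  qed
  have indep: "Q.independent K (B ts)" if "distinct ts" "set ts \<subseteq> std_mono d ` std_index d n" for ts
    using that
  proof (induction ts)
    case Nil
    then show ?case by (simp add: B_def)
  next
    case (Cons t ts)
    have mon: "set (t # ts) \<subseteq> monomials d"
      using Cons.prems std_mono_in_monomials by auto
    then have tc: "Poly_Mapping.single t 1 \<in> carrier ?S"
      by (simp add: poly_ring_single)
    have "q (Poly_Mapping.single t 1) \<notin> Q.Span K (B ts)"
    proof
      assume "q (Poly_Mapping.single t 1) \<in> Q.Span K (B ts)"
      then obtain p where p: "Poly_Mapping.keys p \<subseteq> set ts" "q (Poly_Mapping.single t 1) = q p"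
        using Span[of ts] mon by auto
      have pc: "p \<in> carrier ?S"
        using p(1) mon by (auto simp: in_poly_ring)
      have "gamma_map (Poly_Mapping.single t 1 - p) = 0"
        using q_eq[OF p(2) tc pc] by (simp add: gamma_map_simps)
      moreover have "Poly_Mapping.keys (Poly_Mapping.single t 1 - p) \<subseteq> (\<Union>n. std_mono d ` std_index d n)"
      proof -
        have "Poly_Mapping.keys (Poly_Mapping.single t 1 - p) \<subseteq> set (t # ts)"
          using p(1) by (auto simp: in_keys_iff lookup_minus lookup_single when_def subset_iff split: if_splits)
        then show ?thesis
          using Cons.prems by blast
      qed
      ultimately have "Poly_Mapping.single t 1 - p = 0"
        by (intro std_independent[OF d])
      from arg_cong[OF this, of "\<lambda>p. Poly_Mapping.lookup p t"]
      have "Poly_Mapping.lookup p t = 1"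
        by (simp add: lookup_minus)
      then show False
        using p(1) Cons.prems by (auto simp: in_keys_iff subset_iff)
    qed
    moreover have "q (Poly_Mapping.single t 1) \<in> carrier (?S Quot ?I)"
      using tc by (simp add: q_def)
    ultimately show ?case
      using Cons Q.li_Cons by (simp add: B_def)
  qed
  have "finite (std_mono d ` std_index d n)"
    by (simp add: finite_std_index)
  then obtain ts where ts: "set ts = std_mono d ` std_index d n" "distinct ts"
    using finite_distinct_list by blast
  have len: "length ts = card (std_index d n)"
    using distinct_card[OF ts(2)] card_image[OF std_mono_inj] ts(1) by simp
  have ts_mon: "set ts \<subseteq> monomials d"
    using ts(1) std_mono_in_monomials by auto
  have ts_deg: "mono_deg t = n" if "t \<in> set ts" for t
    using that ts(1) mono_deg_std_mono by auto
  have "q ` {p. Poly_Mapping.keys p \<subseteq> set ts} = q ` graded_piece d n"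
  proof (intro equalityI subsetI)
    fix u assume "u \<in> q ` {p. Poly_Mapping.keys p \<subseteq> set ts}"
    moreover have "{p. Poly_Mapping.keys p \<subseteq> set ts} \<subseteq> graded_piece d n"
      using ts_mon ts_deg by (auto simp: graded_piece_def in_poly_ring)
    ultimately show "u \<in> q ` graded_piece d n" by blast
  next
    fix u assume "u \<in> q ` graded_piece d n"
    then obtain p where p: "p \<in> graded_piece d n" "u = q p" by blast
    obtain p' where p': "Poly_Mapping.keys p' \<subseteq> set ts" "gamma_map p' = gamma_map p"
      using reduce_poly_to_std[OF d p(1)] unfolding ts(1) by blast
    have "q p' = q p"
      using p p' ts_mon by (intro q_eqI) (auto simp: in_poly_ring graded_piece_def)
    then show "u \<in> q ` {p. Poly_Mapping.keys p \<subseteq> set ts}"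
      using p(2) p'(1) by (metis (mono_tags, lifting) image_eqI mem_Collect_eq)
  qed
  then have "Q.dimension (card (std_index d n)) K (q ` graded_piece d n)"
    using Q.dimension_independent[OF indep[OF ts(2)]] Span[OF ts_mon] len ts(1) by (simp add: B_def)
  from Q.dimI[OF K this] show ?thesis
    unfolding hilbert_function_def Let_def over_def K_def q_def by (simp add: image_image)
qed

section \<open>The Hilbert series\<close>

lemma fps_geometric: "Abs_fps (\<lambda>_. 1 :: 'a::field) = inverse (1 - fps_X)"
proof -
  have "inverse (inverse (Abs_fps (\<lambda>_. 1 :: 'a))) = Abs_fps (\<lambda>_. 1)"
    by (rule fps_inverse_idempotent) simp
  then show ?thesis
    by (simp only: fps_inverse_gp')
qed

lemma card_triples:
  "(of_nat (card {(a, e, b). a + e + b = (n::nat)}) :: rat) = fps_nth (Abs_fps (\<lambda>_. 1) ^ 3) n"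
proof -
  \<comment> \<open>A triple is recorded by its partial sums \<open>a + e\<close> and
    \<open>a\<close>, matching the double convolution in the cube of the geometric series.\<close>
  have "bij_betw (\<lambda>(i, j). (j, i - j, n - i)) (SIGMA i:{0..n}. {0..i}) {(a, e, b). a + e + b = n}"
    by (rule bij_betwI[where g = "\<lambda>(a, e, b). (a + e, a)"]) auto
  then have "card {(a, e, b). a + e + b = n} = card (SIGMA i:{0..n}. {0..i})"
    by (simp add: bij_betw_same_card)
  also have "\<dots> = (\<Sum>i=0..n. card {0..i})"
    by (intro card_SigmaI) auto
  finally show ?thesis
    by (simp add: fps_mult_nth power3_eq_cube)
qed

text \<open>For fixed \<open>c\<close> and \<open>p\<close> the exponents \<open>a\<close>,
  \<open>e\<close>, \<open>b\<close> are free, giving a factor \<open>1 / (1 - t)^3\<close>; the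
  variables forced to occur shift the degree by the exponent of \<open>fps_X\<close>.\<close>

lemma card_std_index_fps:
  "Abs_fps (\<lambda>n. of_nat (card (std_index d n)) :: rat) =
   (\<Sum>c<d. \<Sum>p<c. fps_X ^ (of_bool (0 < p) + of_bool (2 \<le> c))) * Abs_fps (\<lambda>_. 1) ^ 3"
proof (rule fps_ext)
  fix n
  let ?w = "\<lambda>(p::nat) (c::nat). of_bool (0 < p) + of_bool (2 \<le> c) :: nat"
  let ?P = "SIGMA c:{..<d}. {..<c}"
  let ?T = "\<lambda>(c, p). {(a, e, b). a + e + b + ?w p c = n}"
  have finT: "finite (?T x)" for x
    by (rule finite_subset[of _ "{..n} \<times> {..n} \<times> {..n}"]) (auto split: prod.splits)
  have card_T: "(of_nat (card {(a, e, b). a + e + b + m = n}) :: rat) =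
      fps_nth (fps_X ^ m * Abs_fps (\<lambda>_. 1) ^ 3) n" for m
  proof (cases "m \<le> n")
    case True
    then have "{(a, e, b). a + e + b + m = n} = {(a, e, b). a + e + b = n - m}"
      by auto
    then show ?thesis
      using True by (simp only: card_triples fps_X_power_mult_nth) simp
  next
    case False
    then have empty: "{(a, e, b). a + e + b + m = n} = {}"
      by auto
    show ?thesis
      unfolding empty using False by (simp add: fps_X_power_mult_nth)
  qed
  have "bij_betw (\<lambda>((c, p), a, e, b). (p, c, a, e, b)) (Sigma ?P ?T) (std_index d n)"
    by (rule bij_betwI[where g = "\<lambda>(p, c, a, e, b). ((c, p), a, e, b)"])
      (auto simp: std_index_def add.assoc split: prod.splits)
  then have "card (std_index d n) = card (Sigma ?P ?T)"
    by (simp add: bij_betw_same_card)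
  also have "\<dots> = (\<Sum>x\<in>?P. card (?T x))"
    using finT by (intro card_SigmaI) auto
  also have "\<dots> = (\<Sum>c<d. \<Sum>p<c. card {(a, e, b). a + e + b + ?w p c = n})"
    by (subst sum.Sigma) (auto intro!: sum.cong)
  finally show "fps_nth (Abs_fps (\<lambda>n. of_nat (card (std_index d n)) :: rat)) n = fps_nth ((\<Sum>c<d. \<Sum>p<c. fps_X ^ ?w p c) * Abs_fps (\<lambda>_. 1) ^ 3) n"
    by (simp only: fps_nth_Abs_fps of_nat_sum card_T sum_distrib_right fps_sum_nth)
qed

text \<open>No variable is forced for \<open>c = 1\<close>, one for \<open>p = 0\<close> and
  \<open>2 \<le> c < d\<close>, and two for each of the \<open>(d - 1) choose 2\<close> pairs
  \<open>1 \<le> p < c < d\<close>.\<close>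

lemma sum_class_weights:
  assumes "2 \<le> d"
  shows "(\<Sum>c<d. \<Sum>p<c. (x::'a::comm_ring_1) ^ (of_bool (0 < p) + of_bool (2 \<le> c))) =
    1 + of_nat (d - 2) * x + of_nat ((d - 1) choose 2) * x ^ 2"
  using assms
proof (induction d rule: dec_induct)
  case base
  then show ?case by (simp add: numeral_2_eq_2 lessThan_Suc)
next
  case (step d)
  obtain m where m: "d = Suc (Suc m)"
    using step(1) by (metis add_2_eq_Suc le_Suc_ex)
  \<comment> \<open>This is the contribution of the new value \<open>c = d\<close>:
    \<open>p = 0\<close> gives \<open>x\<close>, and the \<open>d - 1 = Suc m\<close> positive
    values of \<open>p\<close> give \<open>x ^ 2\<close> each.\<close>
  have "(\<Sum>p<d. x ^ (of_bool (0 < p) + of_bool (2 \<le> d))) = x + of_nat (Suc m) * x ^ 2"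
    unfolding m by (subst sum.lessThan_Suc_shift) (simp add: power2_eq_square)
  then show ?case
    using step.IH unfolding m by (simp add: numeral_2_eq_2 algebra_simps)
qed

theorem proposition4p4:
  fixes d :: nat
  assumes "d \<ge> 3"
  shows "homogeneous_ideal d (gamma_ideal d) \<and>
    primeideal (gamma_ideal d) (poly_ring d) \<and>
    (\<forall>r. antidiagonal_term_order d (gamma_matrix d) r \<longrightarrow>
           groebner_basis d r (gamma_ideal d) (minors3 (gamma_matrix d))) \<and>
    hilbert_series d (gamma_ideal d) =
      (1 + of_nat (d - 2) * fps_X + of_nat ((d - 1) choose 2) * fps_X ^ 2) / (1 - fps_X) ^ 3"
proof -
  have d: "2 \<le> d" using assms by simp
  have "homogeneous_ideal d (gamma_kernel d)"
    unfolding homogeneous_ideal_def using ideal_gamma_kernel hom_component_kernel by blast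
  moreover have "hilbert_series d (gamma_kernel d) =
      (1 + of_nat (d - 2) * fps_X + of_nat ((d - 1) choose 2) * fps_X ^ 2) / (1 - fps_X) ^ 3"
    unfolding hilbert_series_def hilbert_function_eq[OF d] card_std_index_fps sum_class_weights[OF d] fps_geometric
    by (subst fps_divide_unit) (simp_all add: fps_inverse_power)
  ultimately show ?thesis
    unfolding gamma_ideal_eq_kernel
    using primeideal_gamma_kernel groebner_basis_minors[OF d] by blast
qed

end
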